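(* Assume that $K$ is a p.c.f. self-similar set. Let $0<\alpha\le s$ and $\alpha/s<p\le\infty$. Then $f\in L^p(K,H^{\alpha}_\mu)$ if and only if $M_{\mathcal{D}}^\mu f\in L^p(K,H^{\alpha}_\mu)$. Moreover, there exists a positive constant $C$ such that, for all such $f$, $$\|f\|_{L^p(K,H^{\alpha}_\mu)}\le \|M_{\mathcal{D}}^\mu f\|_{L^p(K,H^{\alpha}_\mu)}\le C\|f\|_{L^p(K,H^{\alpha}_\mu)}.$$
   Context: Self-similar set and measure. For $1\le i\le m$ let $S_i:\mathbb{R}^d\to\mathbb{R}^d$, $S_i(x)=r_iR_i(x)+b_i$ with $0<r_i<1$, $b_i\in\mathbb{R}^d$, $R_i$ orthogonal. $K\subset\mathbb{R}^d$ is the unique nonempty compact set with $K=\bigcup_{i=1}^m S_i(K)$ (the self-similar set generated by $\{S_i\}_{i=1}^m$). It is always assumed that the $S_i$ do not all share a common fixed point. Given a probability vector $(p_1,\dots,p_m)$ with all $p_i>0$ and $\sum_i p_i=1$, $\mu$ is the unique Borel probability measure with $\mu=\sum_{i=1}^m p_i\,\mu\circ S_i^{-1}$ (self-similar measure; it is supported on $K$). $s$ denotes the Hausdorff dimension of $K$. Basic cubes. $\Sigma_n=\{1,\dots,m\}^n$ for $n\ge1$, $\Sigma_0=\{\emptyset\}$ (empty word). For $\mathbf{i}=i_1\ldots i_n$, $S_{\mathbf{i}}=S_{i_1}\circ\cdots\circ S_{i_n}$ and $K_{\mathbf{i}}=S_{\mathbf{i}}(K)$; $K_\emptyset=K$.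 $\mathcal{D}=\bigcup_{n\ge0}\{K_{\mathbf{i}}:\mathbf{i}\in\Sigma_n\}$ is the collection of basic cubes. P.c.f. Let $\Sigma_\infty=\{1,\dots,m\}^{\mathbb{N}}$, let $\Pi:\Sigma_\infty\to K$ be the coding map, $\{\Pi(\mathbf{i})\}=\bigcap_{n\ge1}K_{i_1\ldots i_n}$, and let $\sigma$ be the shift $\sigma(i_1,i_2,\dots)=(i_2,i_3,\dots)$. Put $\mathcal{C}_K=\bigcup_{i\ne j}(S_i(K)\cap S_j(K))$ and $\mathcal{C}=\Pi^{-1}(\mathcal{C}_K)$. $K$ is post-critically finite (p.c.f.) if $\bigcup_{n\ge1}\sigma^n(\mathcal{C})$ is a finite set. Hausdorff content. For $E\subset K$ and $0<\alpha\le s$, $H^\alpha_\mu(E)=\inf\{\sum_j\mu(I_j)^{\alpha/s}: E\subset\bigcup_jI_j,\ I_j\in\mathcal{D}\}$, over countable (possibly finite) covers. Choquet integral and spaces. Functions on $K$ are taken to be $\mu$-measurable. For $0<p<\infty$, $\|f\|^p_{L^p(K,H^\alpha_\mu)}=\int_K|f|^p\,dH^\alpha_\mu:=p\int_0^\infty t^{p-1}H^\alpha_\mu(\{x\in K:|f(x)|>t\})\,dt$, and $L^p(K,H^\alpha_\mu)$ is the space of functions $f$ on $K$ for which this is finite. $L^\infty(K,H^\alpha_\mu)$ is the space of functions $g$ on $K$ with $\|g\|_{L^\infty(K,H^\alpha_\mu)}:=\inf_{E_0\subset K,\,H^\alpha_\mu(E_0)=0}\ \sup_{x\in K\setminus E_0}|g(x)|<\infty$.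 Maximal operator. $M_{\mathcal{D}}^\mu f(x)=\sup\frac{1}{\mu(K_{\mathbf{i}})}\int_{K_{\mathbf{i}}}|f|\,d\mu$ for $x\in K$, the supremum being over all $n\in\mathbb{N}=\{1,2,\dots\}$ and all $\mathbf{i}\in\Sigma_n$ with $x\in K_{\mathbf{i}}$.
   Formalization: The norm of f (not of its maximal function) is taken as the infimum over measurable functions equal to f μ-a.e., and f lies in L^p if this is finite; pointwise the lower bound and the "if" fail for α<s, e.g. for the indicator of a μ-null set of positive content. *)

theory Defs
  imports "HOL-Analysis.Analysis"
begin

section \<open>Self-similar sets and measures\<close>

definition contracting_similarity :: "('a::euclidean_space \<Rightarrow> 'a) \<Rightarrow> bool" where
  "contracting_similarity f \<longleftrightarrow>
     (\<exists>r R b. 0 < r \<and> r < 1 \<and> orthogonal_transformation R \<and> f = (\<lambda>x. r *\<^sub>R R x + b))"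

text \<open>The maps are \<open>S 1, \<dots>, S m\<close>; values of \<open>S\<close> at other indices play no role.\<close>

definition self_similar_set :: "nat \<Rightarrow> (nat \<Rightarrow> 'a::euclidean_space \<Rightarrow> 'a) \<Rightarrow> 'a set \<Rightarrow> bool" where
  "self_similar_set m S K \<longleftrightarrow> K \<noteq> {} \<and> compact K \<and> K = (\<Union>i\<in>{1..m}. S i ` K)"

definition self_similar_measure ::
    "nat \<Rightarrow> (nat \<Rightarrow> 'a::euclidean_space \<Rightarrow> 'a) \<Rightarrow> (nat \<Rightarrow> real) \<Rightarrow> 'a measure \<Rightarrow> bool" where
  "self_similar_measure m S q \<mu> \<longleftrightarrow>
     sets \<mu> = sets borel \<and> emeasure \<mu> UNIV = 1 \<and>
     (\<forall>A\<in>sets borel. emeasure \<mu> A = (\<Sum>i=1..m. ennreal (q i) * emeasure \<mu> (S i -` A)))"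

definition words :: "nat \<Rightarrow> nat \<Rightarrow> nat list set" where
  "words m n = {w. length w = n \<and> set w \<subseteq> {1..m}}"

definition word_map :: "(nat \<Rightarrow> 'a \<Rightarrow> 'a) \<Rightarrow> nat list \<Rightarrow> 'a \<Rightarrow> 'a" where
  "word_map S w = foldr (\<circ>) (map S w) id"

definition cube :: "(nat \<Rightarrow> 'a \<Rightarrow> 'a) \<Rightarrow> 'a set \<Rightarrow> nat list \<Rightarrow> 'a set" where
  "cube S K w = word_map S w ` K"

definition basic_cubes :: "nat \<Rightarrow> (nat \<Rightarrow> 'a \<Rightarrow> 'a) \<Rightarrow> 'a set \<Rightarrow> 'a set set" where
  "basic_cubes m S K = (\<Union>n. cube S K ` words m n)"


section \<open>Post-critical finiteness\<close>

text \<open>Infinite sequences are indexed from \<open>0\<close>: the \<open>n\<close>-th letter of \<open>\<omega>\<close> is \<open>\<omega> (n - 1)\<close>.\<close>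

definition sequences :: "nat \<Rightarrow> (nat \<Rightarrow> nat) set" where
  "sequences m = {\<omega>. \<forall>n. \<omega> n \<in> {1..m}}"

definition coding_map :: "(nat \<Rightarrow> 'a \<Rightarrow> 'a) \<Rightarrow> 'a set \<Rightarrow> (nat \<Rightarrow> nat) \<Rightarrow> 'a" where
  "coding_map S K \<omega> = the_elem (\<Inter>n\<in>{1..}. cube S K (map \<omega> [0..<n]))"

definition shift :: "(nat \<Rightarrow> nat) \<Rightarrow> (nat \<Rightarrow> nat)" where
  "shift \<omega> = (\<lambda>n. \<omega> (Suc n))"

definition overlap_set :: "nat \<Rightarrow> (nat \<Rightarrow> 'a \<Rightarrow> 'a) \<Rightarrow> 'a set \<Rightarrow> 'a set" where
  "overlap_set m S K = (\<Union>i\<in>{1..m}. \<Union>j\<in>{1..m} - {i}. S i ` K \<inter> S j ` K)"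

definition critical_set :: "nat \<Rightarrow> (nat \<Rightarrow> 'a \<Rightarrow> 'a) \<Rightarrow> 'a set \<Rightarrow> (nat \<Rightarrow> nat) set" where
  "critical_set m S K = {\<omega> \<in> sequences m. coding_map S K \<omega> \<in> overlap_set m S K}"

definition post_critically_finite :: "nat \<Rightarrow> (nat \<Rightarrow> 'a \<Rightarrow> 'a) \<Rightarrow> 'a set \<Rightarrow> bool" where
  "post_critically_finite m S K \<longleftrightarrow>
     finite (\<Union>n\<in>{1..}. (shift ^^ n) ` critical_set m S K)"


section \<open>Hausdorff dimension\<close>

text \<open>Only positive exponents \<open>t\<close> are used, so that a set of diameter \<open>0\<close> contributes
  \<open>0 powr t = 0\<close>. The boundedness requirement is needed because \<^const>\<open>diameter\<close> has no
  meaningful value on unbounded sets.\<close>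

definition hausdorff_premeasure :: "real \<Rightarrow> real \<Rightarrow> 'a::euclidean_space set \<Rightarrow> ennreal" where
  "hausdorff_premeasure t \<delta> E =
     (INF U\<in>{U :: nat \<Rightarrow> 'a set. E \<subseteq> (\<Union>j. U j) \<and> (\<forall>j. bounded (U j) \<and> diameter (U j) \<le> \<delta>)}.
        \<Sum>j. ennreal (diameter (U j) powr t))"

definition hausdorff_measure :: "real \<Rightarrow> 'a::euclidean_space set \<Rightarrow> ennreal" where
  "hausdorff_measure t E = (SUP \<delta>\<in>{0<..}. hausdorff_premeasure t \<delta> E)"

definition hausdorff_dim :: "'a::euclidean_space set \<Rightarrow> real" where
  "hausdorff_dim E = Inf {t. 0 < t \<and> hausdorff_measure t E = 0}"


section \<open>Hausdorff content and Choquet integrals\<close>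

text \<open>Covers are sequences; the empty set is admitted as a further member, at cost
  \<open>0 powr (\<alpha> / s) = 0\<close>, so that finite covers are included.\<close>

definition cube_content ::
    "nat \<Rightarrow> (nat \<Rightarrow> 'a::euclidean_space \<Rightarrow> 'a) \<Rightarrow> 'a set \<Rightarrow> 'a measure \<Rightarrow> real \<Rightarrow> 'a set \<Rightarrow> ennreal" where
  "cube_content m S K \<mu> \<alpha> E =
     (INF I\<in>{I :: nat \<Rightarrow> 'a set. (\<forall>j. I j \<in> insert {} (basic_cubes m S K)) \<and> E \<subseteq> (\<Union>j. I j)}.
        \<Sum>j. ennreal (measure \<mu> (I j) powr (\<alpha> / hausdorff_dim K)))"

definition choquet_power_integral ::
    "'a set \<Rightarrow> ('a set \<Rightarrow> ennreal) \<Rightarrow> real \<Rightarrow> ('a \<Rightarrow> ennreal) \<Rightarrow> ennreal" where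
  "choquet_power_integral K H p u =
     ennreal p *
     (\<integral>\<^sup>+ t \<in> {0<..}. ennreal (t powr (p - 1)) * H {x \<in> K. u x > ennreal t} \<partial>lborel)"

definition ess_sup_content :: "'a set \<Rightarrow> ('a set \<Rightarrow> ennreal) \<Rightarrow> ('a \<Rightarrow> ennreal) \<Rightarrow> ennreal" where
  "ess_sup_content K H u = (INF E\<in>{E. E \<subseteq> K \<and> H E = 0}. SUP x\<in>K - E. u x)"

text \<open>The norm of a function enters only through its absolute value, an everywhere defined
  function \<open>u\<close> with values in \<open>[0, \<infinity>]\<close>.\<close>

definition content_norm ::
    "'a set \<Rightarrow> ('a set \<Rightarrow> ennreal) \<Rightarrow> ennreal \<Rightarrow> ('a \<Rightarrow> ennreal) \<Rightarrow> ennreal" where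
  "content_norm K H p u =
     (if p = \<infinity> then ess_sup_content K H u
      else let J = choquet_power_integral K H (enn2real p) u in
        if J = \<infinity> then \<infinity> else ennreal (enn2real J powr (1 / enn2real p)))"

text \<open>\<open>\<mu>\<close>-measurable functions are identified when they agree \<open>\<mu>\<close>-almost everywhere, whereas
  for \<open>\<alpha> < s\<close> a \<open>\<mu>\<close>-null set may have positive content. The norm of \<open>f\<close> is therefore the
  infimum of the norms of its versions. Without this, the indicator \<open>f\<close> of a \<open>\<mu>\<close>-null set of
  positive content would have positive norm although its maximal function vanishes.\<close>

definition version_norm ::
    "'a set \<Rightarrow> 'a measure \<Rightarrow> ('a set \<Rightarrow> ennreal) \<Rightarrow> ennreal \<Rightarrow> ('a \<Rightarrow> real) \<Rightarrow> ennreal" where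
  "version_norm K \<mu> H p f =
     (INF g\<in>{g \<in> borel_measurable (completion \<mu>). AE x in \<mu>. g x = f x}.
        content_norm K H p (\<lambda>x. ennreal \<bar>g x\<bar>))"

definition content_space ::
    "'a set \<Rightarrow> 'a measure \<Rightarrow> ('a set \<Rightarrow> ennreal) \<Rightarrow> ennreal \<Rightarrow> ('a \<Rightarrow> real) set" where
  "content_space K \<mu> H p =
     {f \<in> borel_measurable (completion \<mu>). version_norm K \<mu> H p f < \<infinity>}"

text \<open>The space for functions with values in \<open>[0, \<infinity>]\<close>, such as the maximal function. No
  versions are taken here: the maximal function is defined at every point and is the same for
  all versions of \<open>f\<close>.\<close>

definition content_space_nonneg ::
    "'a set \<Rightarrow> 'a measure \<Rightarrow> ('a set \<Rightarrow> ennreal) \<Rightarrow> ennreal \<Rightarrow> ('a \<Rightarrow> ennreal) set" where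
  "content_space_nonneg K \<mu> H p =
     {u \<in> borel_measurable (completion \<mu>). content_norm K H p u < \<infinity>}"


section \<open>The maximal operator\<close>

definition maximal_function ::
    "nat \<Rightarrow> (nat \<Rightarrow> 'a \<Rightarrow> 'a) \<Rightarrow> 'a set \<Rightarrow> 'a measure \<Rightarrow> ('a \<Rightarrow> real) \<Rightarrow> 'a \<Rightarrow> ennreal" where
  "maximal_function m S K \<mu> f x =
     (SUP w\<in>{w \<in> (\<Union>n\<in>{1..}. words m n). x \<in> cube S K w}.
        (\<integral>\<^sup>+ y \<in> cube S K w. ennreal \<bar>f y\<bar> \<partial>completion \<mu>) / emeasure \<mu> (cube S K w))"

end

theory Submission
  imports Defs "HOL-Library.Sublist"
begin

text \<open>
  Put \<open>\<beta> = \<alpha> / s\<close>, so that \<open>0 < \<beta> \<le> 1\<close> and a cube \<open>Q w\<close> contributes \<open>\<mu>(Q w)\<^sup>\<beta>\<close> to the content.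
  Although cubes may touch, everything below runs on the tree of words: post-critical finiteness
  makes the overlap of two first-level cubes finite, and \<open>\<mu>\<close> has no atoms because the maps have no
  common fixed point. Hence the cubes of two words, neither of which is a prefix of the other, meet
  in a null set (\<open>parallel_cubes_null\<close>), while every cube has positive measure.

  The left inequality is Lebesgue differentiation, \<open>\<bar>f\<bar> \<le> M f\<close> almost everywhere
  (\<open>AE_le_maximal_function\<close>): changing \<open>f\<close> to \<open>0\<close> on the exceptional null set gives a version that
  \<open>M f\<close> dominates at every point.

  For the right inequality with \<open>p < \<infinity>\<close> the heart is the level set estimate
  (\<open>content_maximal_level_set\<close>), for \<open>t > 0\<close>,
  \<open>H {M g > t} \<le> (\<Sum>j. 3 * 2^(j \<beta>) * H {\<bar>g\<bar> > 2^(j-1) t})\<close>, with \<open>j\<close> ranging over the naturals.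
  Cover each set \<open>{\<bar>g\<bar> > 2^(j-1) t}\<close> by cubes with words in \<open>A j\<close>, and let \<open>v\<close> be a shortest word on
  whose cube the mean of \<open>\<bar>g\<bar>\<close> reaches \<open>t\<close>. If \<open>v\<close> extends a word of some \<open>A j\<close>, its cube is already
  covered. Otherwise the part of \<open>g\<close> above \<open>t / 2\<close> that lives on \<open>Q v\<close> is carried by covering cubes
  inside \<open>Q v\<close>, whence \<open>\<mu>(Q v) \<le> \<Sum>j. 2^(j+1) \<Sum>w. \<mu>(Q w)\<close>, summed over the extensions \<open>w \<in> A j\<close> of \<open>v\<close>.
  As \<open>\<beta> \<le> 1\<close>, the power \<open>\<beta>\<close> may be applied term by term on the right, and in the sum over all such \<open>v\<close> every
  \<open>w\<close> occurs at most once, since the shortest words form an antichain. Multiplying the level set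
  estimate by \<open>p t^(p-1)\<close> and integrating over \<open>t\<close> turns the \<open>j\<close>-th term into a constant times
  \<open>2^(j (\<beta> - p))\<close> times the Choquet integral of \<open>\<bar>g\<bar>^p\<close>; the geometric series converges precisely
  because \<open>p > \<beta>\<close>.

  For \<open>p = \<infinity>\<close> a set of content zero is \<open>\<mu>\<close>-null, so all means of \<open>\<bar>g\<bar>\<close> are bounded by its essential
  supremum. Since \<open>M\<close> does not distinguish versions of \<open>f\<close>, the bounds pass to the infimum over all
  versions.
\<close>

section \<open>Words and cubes\<close>

lemma contracting_similarityE:
  assumes "contracting_similarity f"
  obtains r where "0 < r" "r < 1" "\<And>x y. dist (f x) (f y) = r * dist x y"
proof -
  obtain r R b where r: "0 < r" "r < 1" and R: "orthogonal_transformation R"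
    and f: "f = (\<lambda>x. r *\<^sub>R R x + b)"
    using assms unfolding contracting_similarity_def by blast
  have "dist (f x) (f y) = r * dist x y" for x y
  proof -
    have "dist (f x) (f y) = norm (r *\<^sub>R (R x - R y))"
      by (simp add: f dist_norm scaleR_diff_right)
    also have "\<dots> = r * dist (R x) (R y)" using r by (simp add: dist_norm)
    finally show ?thesis using R by (simp add: orthogonal_transformation_isometry)
  qed
  with r that show thesis by blast
qed

lemma word_map_Nil [simp]: "word_map S [] = id"
  and word_map_Cons [simp]: "word_map S (i # w) = S i \<circ> word_map S w"
  by (simp_all add: word_map_def)

lemma word_map_append: "word_map S (u @ v) = word_map S u \<circ> word_map S v"
  by (induction u) (simp_all add: comp_assoc)

lemma cube_Nil [simp]: "cube S K [] = K"
  by (simp add: cube_def)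

lemma cube_Cons: "cube S K (i # w) = S i ` cube S K w"
  by (simp add: cube_def image_comp)

lemma cube_append: "cube S K (u @ v) = word_map S u ` cube S K v"
  by (simp add: cube_def word_map_append image_comp)

lemma Union_words_lists: "(\<Union>n. words m n) = lists {1..m}"
  by (auto simp: words_def)

lemma Union_words_nonempty: "(\<Union>n\<in>{1..}. words m n) = lists {1..m} - {[]}"
  by (force simp: words_def Suc_le_eq)

lemma basic_cubes_eq: "basic_cubes m S K = cube S K ` lists {1..m}"
  by (simp add: basic_cubes_def Union_words_lists flip: image_UN)

text \<open>Stopping words: of all prefixes of a word with some property, choose the shortest.\<close>

lemma minimal_prefix:
  assumes "P v"
  obtains u where "prefix u v" "P u" "\<And>w. strict_prefix w u \<Longrightarrow> \<not> P w"
proof -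
  obtain u where u: "prefix u v \<and> P u"
    and min: "\<And>w. prefix w v \<and> P w \<Longrightarrow> length u \<le> length w"
    using ex_has_least_nat[of "\<lambda>u. prefix u v \<and> P u" v length] assms by auto
  have "\<not> P w" if "strict_prefix w u" for w
    using min[of w] prefix_length_less[OF that] u that
    by (meson linorder_not_le prefix_order.less_imp_le prefix_order.trans)
  with u that show thesis by blast
qed

text \<open>The prefixes of a fixed word form a chain, so an antichain meets them at most once. This is what
  counts every covering cube only once in the level set estimate.\<close>

lemma antichain_extensions_unique:
  assumes "prefix u w" "prefix v w" "\<not> strict_prefix u v" "\<not> strict_prefix v u"
  shows "u = v"
  using assms by (metis prefix_same_cases prefix_order.order_iff_strict)


section \<open>The self-similar set and its measure\<close>

locale self_similar_system =
  fixes S :: "nat \<Rightarrow> 'a::euclidean_space \<Rightarrow> 'a" and m :: nat and K :: "'a set"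
    and q :: "nat \<Rightarrow> real" and \<mu> :: "'a measure"
  assumes contr: "\<And>i. i \<in> {1..m} \<Longrightarrow> contracting_similarity (S i)"
    and no_common_fixpoint: "\<not> (\<exists>x. \<forall>i\<in>{1..m}. S i x = x)"
    and self_similar: "self_similar_set m S K"
    and q_pos: "\<And>i. i \<in> {1..m} \<Longrightarrow> 0 < q i" and q_sum: "(\<Sum>i=1..m. q i) = 1"
    and self_similar_mu: "self_similar_measure m S q \<mu>"
begin

abbreviation Q :: "nat list \<Rightarrow> 'a set" where "Q \<equiv> cube S K"

abbreviation W :: "nat list set" where "W \<equiv> lists {1..m}"

lemma m_pos: "1 \<le> m"
  using q_sum by (cases m) auto

lemma uniform_ratio:
  obtains r where "0 < r" "r < 1"
    "\<And>i x y. i \<in> {1..m} \<Longrightarrow> dist (S i x) (S i y) \<le> r * dist x y"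
proof -
  have "\<forall>i\<in>{1..m}. \<exists>r. 0 < r \<and> r < 1 \<and> (\<forall>x y. dist (S i x) (S i y) = r * dist x y)"
    by (meson contr contracting_similarityE)
  then obtain r where r: "\<And>i. i \<in> {1..m} \<Longrightarrow>
      0 < r i \<and> r i < 1 \<and> (\<forall>x y. dist (S i x) (S i y) = r i * dist x y)"
    by metis
  define R where "R = Max (r ` {1..m})"
  have ne: "finite (r ` {1..m})" "r ` {1..m} \<noteq> {}" using m_pos by auto
  have "0 < R" "R < 1"
    using r ne m_pos unfolding R_def by (auto simp: Max_gr_iff Bex_def intro!: exI[of _ 1])
  moreover have "dist (S i x) (S i y) \<le> R * dist x y" if "i \<in> {1..m}" for i x y
  proof -
    have "r i \<le> R" using that ne unfolding R_def by (intro Max_ge) auto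
    then show ?thesis using r[OF that] by (simp add: mult_right_mono)
  qed
  ultimately show thesis using that by blast
qed

lemma continuous_S: "i \<in> {1..m} \<Longrightarrow> continuous_on A (S i)"
proof -
  assume i: "i \<in> {1..m}"
  obtain r where r: "0 < r" "r < 1" "\<And>x y. dist (S i x) (S i y) = r * dist x y"
    using contr[OF i] contracting_similarityE by blast
  show ?thesis
    unfolding continuous_on_iff
  proof (intro ballI allI impI)
    fix x e :: real assume "0 < e" 
    fix y assume "y \<in> A"
    show "\<exists>d>0. \<forall>x'\<in>A. dist x' y < d \<longrightarrow> dist (S i x') (S i y) < e"
      using r \<open>0 < e\<close> by (intro exI[of _ "e / r"]) (auto simp: field_simps)
  qed
qed

lemma inj_S: "i \<in> {1..m} \<Longrightarrow> inj (S i)"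
proof (rule injI)
  fix x y assume i: "i \<in> {1..m}" and "S i x = S i y"
  moreover obtain r where "0 < r" "\<And>x y. dist (S i x) (S i y) = r * dist x y"
    using contr[OF i] contracting_similarityE by blast
  ultimately show "x = y" by (metis dist_eq_0_iff mult_eq_0_iff order_less_irrefl)
qed

lemma vimage_S_borel: "i \<in> {1..m} \<Longrightarrow> A \<in> sets borel \<Longrightarrow> S i -` A \<in> sets borel"
  using borel_measurable_continuous_onI[OF continuous_S] measurable_sets[of "S i" borel borel A]
  by simp

lemma K_nonempty: "K \<noteq> {}" and compact_K: "compact K" and K_eq: "K = (\<Union>i\<in>{1..m}. S i ` K)"
  using self_similar by (simp_all add: self_similar_set_def)

lemma sets_mu [measurable_cong, simp]: "sets \<mu> = sets borel"
  and emeasure_mu_UNIV: "emeasure \<mu> UNIV = 1"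
  and emeasure_mu_eq: "A \<in> sets borel \<Longrightarrow>
    emeasure \<mu> A = (\<Sum>i=1..m. ennreal (q i) * emeasure \<mu> (S i -` A))"
  using self_similar_mu by (simp_all add: self_similar_measure_def)

lemma space_mu [simp]: "space \<mu> = UNIV"
  using sets_eq_imp_space_eq[OF sets_mu] by simp

sublocale finite_measure \<mu>
  by (rule finite_measureI) (simp add: emeasure_mu_UNIV)

lemma measure_mu_UNIV: "measure \<mu> UNIV = 1"
  by (simp add: measure_def emeasure_mu_UNIV)

lemma measure_mu_le_1: "measure \<mu> A \<le> 1"
  using bounded_measure[of A] measure_mu_UNIV by simp

lemma measure_mu_eq:
  assumes "A \<in> sets borel"
  shows "measure \<mu> A = (\<Sum>i=1..m. q i * measure \<mu> (S i -` A))"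
proof -
  have "ennreal (measure \<mu> A) = (\<Sum>i=1..m. ennreal (q i * measure \<mu> (S i -` A)))"
    unfolding emeasure_eq_measure[symmetric] emeasure_mu_eq[OF assms]
    using q_pos by (intro sum.cong refl) (simp add: emeasure_eq_measure ennreal_mult less_imp_le)
  also have "\<dots> = ennreal (\<Sum>i=1..m. q i * measure \<mu> (S i -` A))"
    using q_pos by (intro sum_ennreal) (simp add: less_imp_le)
  finally show ?thesis
    using q_pos
    by (subst (asm) ennreal_inj) (auto intro!: sum_nonneg mult_nonneg_nonneg simp: less_imp_le)
qed

lemma compact_cube: "w \<in> W \<Longrightarrow> compact (Q w)"
  by (induction w) (auto simp: cube_Cons compact_K intro!: compact_continuous_image continuous_S)

lemma cube_borel [measurable]: "w \<in> W \<Longrightarrow> Q w \<in> sets borel"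
  by (simp add: compact_cube borel_compact)

lemma cube_subset_K: "w \<in> W \<Longrightarrow> Q w \<subseteq> K"
proof (induction w)
  case (Cons i w)
  then have "Q (i # w) \<subseteq> S i ` K" by (auto simp: cube_Cons)
  also have "\<dots> \<subseteq> K" using Cons.prems by (subst (2) K_eq) auto
  finally show ?case .
qed simp

lemma cube_antimono:
  assumes "prefix v w" "w \<in> W"
  shows "Q w \<subseteq> Q v"
proof -
  obtain u where w: "w = v @ u" using assms by (auto simp: prefix_def)
  then have "Q u \<subseteq> K" using assms by (intro cube_subset_K) auto
  then show ?thesis unfolding w cube_append by (auto simp: cube_def)
qed

text \<open>By invariance \<open>\<mu> (S i ` A) \<ge> q i \<mu> A\<close>; the mass of \<open>K\<close>, from which the induction starts, is determined
  below.\<close>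

lemma cube_measure_pos:
  assumes "0 < measure \<mu> K" "w \<in> W"
  shows "0 < measure \<mu> (Q w)"
  using assms(2)
proof (induction w)
  case (Cons i w)
  then have i: "i \<in> {1..m}" and w: "w \<in> W" and iw: "i # w \<in> W" by auto
  have "Q w \<subseteq> S i -` Q (i # w)" by (auto simp: cube_Cons)
  then have "measure \<mu> (Q w) \<le> measure \<mu> (S i -` Q (i # w))"
    using vimage_S_borel[OF i cube_borel[OF iw]] by (intro finite_measure_mono) auto
  then have "0 < q i * measure \<mu> (S i -` Q (i # w))"
    using Cons.IH q_pos[OF i] by simp
  also have "\<dots> \<le> (\<Sum>j=1..m. q j * measure \<mu> (S j -` Q (i # w)))"
    using i q_pos by (intro member_le_sum) (auto simp: less_imp_le)
  finally show ?case using measure_mu_eq[OF cube_borel[OF iw]] by simp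
qed (simp add: assms(1))

text \<open>The closed neighbourhoods \<open>U d\<close> of \<open>K\<close> satisfy \<open>U (d / r) \<subseteq> S i -` U d\<close> for the contraction ratio \<open>r\<close>,
  so invariance of \<open>\<mu>\<close> gives \<open>\<mu> (U (d / r)) \<le> \<mu> (U d)\<close>. Iterating, the neighbourhood on the left grows to
  the whole space, and hence all \<open>U d\<close> have full measure; finally let \<open>d\<close> tend to \<open>0\<close>.\<close>

lemma measure_K: "measure \<mu> K = 1"
proof -
  obtain r where r: "0 < r" "r < 1"
    and S: "\<And>i x y. i \<in> {1..m} \<Longrightarrow> dist (S i x) (S i y) \<le> r * dist x y"
    by (rule uniform_ratio) blast
  define U where "U d = {x. infdist x K \<le> d}" for d
  have closed_U: "closed (U d)" for d
    unfolding U_def by (intro closed_Collect_le continuous_intros)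
  have borel_U [measurable]: "U d \<in> sets borel" for d
    using closed_U by (rule borel_closed)
  have step: "measure \<mu> (U (d / r)) \<le> measure \<mu> (U d)" for d
  proof -
    have "U (d / r) \<subseteq> S i -` U d" if i: "i \<in> {1..m}" for i
    proof
      fix x assume "x \<in> U (d / r)"
      then have x: "infdist x K \<le> d / r" by (simp add: U_def)
      obtain y where y: "y \<in> K" "infdist x K = dist x y"
        using infdist_attains_inf[OF compact_imp_closed[OF compact_K] K_nonempty] by blast
      have "S i y \<in> K" using i y(1) by (subst K_eq) auto
      then have "infdist (S i x) K \<le> dist (S i x) (S i y)" by (rule infdist_le)
      also have "\<dots> \<le> r * dist x y" by (rule S[OF i])
      also have "\<dots> \<le> d" using x y r by (simp add: field_simps)
      finally show "x \<in> S i -` U d" by (simp add: U_def)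
    qed
    then have "(\<Sum>i=1..m. q i * measure \<mu> (U (d / r))) \<le> (\<Sum>i=1..m. q i * measure \<mu> (S i -` U d))"
      using q_pos vimage_S_borel
      by (intro sum_mono mult_left_mono finite_measure_mono) (auto simp: less_imp_le)
    then show ?thesis
      using measure_mu_eq[OF borel_U] q_sum by (simp flip: sum_distrib_right)
  qed
  have U_1: "measure \<mu> (U d) = 1" if d: "0 < d" for d
  proof -
    have mono: "measure \<mu> (U (d / r ^ n)) \<le> measure \<mu> (U d)" for n
    proof (induction n)
      case (Suc n)
      then show ?case using step[of "d / r ^ n"] by (simp add: mult.commute)
    qed simp
    have "incseq (\<lambda>n. U (d / r ^ n))"
    proof (rule incseq_SucI)
      fix n
      have "d / r ^ n \<le> d / r ^ Suc n" using d r by (simp add: field_simps)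
      then show "U (d / r ^ n) \<subseteq> U (d / r ^ Suc n)" by (auto simp: U_def)
    qed
    moreover have "(\<Union>n. U (d / r ^ n)) = UNIV"
    proof (intro equalityI subset_UNIV subsetI)
      fix x :: 'a
      obtain n where "(1 / r) ^ n > infdist x K / d"
        using r real_arch_pow[of "1 / r"] by auto
      then have "infdist x K \<le> d / r ^ n" using d by (simp add: field_simps)
      then show "x \<in> (\<Union>n. U (d / r ^ n))" by (auto simp: U_def)
    qed
    ultimately have "(\<lambda>n. measure \<mu> (U (d / r ^ n))) \<longlonglongrightarrow> 1"
      using finite_Lim_measure_incseq[of "\<lambda>n. U (d / r ^ n)"] measure_mu_UNIV by (simp add: image_subset_iff)
    then have "1 \<le> measure \<mu> (U d)"
      by (rule LIMSEQ_le_const2) (use mono in auto)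
    then show ?thesis using measure_mu_le_1[of "U d"] by simp
  qed
  have "decseq (\<lambda>n. U (inverse (real (Suc n))))"
    by (rule decseq_SucI) (auto simp: U_def intro: order_trans le_imp_inverse_le)
  moreover have "(\<Inter>n. U (inverse (real (Suc n)))) = K"
  proof (intro equalityI subsetI)
    fix x assume "x \<in> (\<Inter>n. U (inverse (real (Suc n))))"
    then have "infdist x K \<le> inverse (real (Suc n))" for n by (auto simp: U_def)
    then have "infdist x K \<le> 0"
      using LIMSEQ_inverse_real_of_nat by (intro LIMSEQ_le_const) auto
    then have "infdist x K = 0" by (intro order_antisym infdist_nonneg)
    then show "x \<in> K"
      by (rule in_closed_iff_infdist_zero[OF compact_imp_closed[OF compact_K] K_nonempty, THEN iffD2])
  qed (auto simp: U_def)
  ultimately have "(\<lambda>n. measure \<mu> (U (inverse (real (Suc n))))) \<longlonglongrightarrow> measure \<mu> K"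
    using finite_Lim_measure_decseq[of "\<lambda>n. U (inverse (real (Suc n)))"]
    by (simp add: image_subset_iff)
  then have "(\<lambda>n::nat. 1::real) \<longlonglongrightarrow> measure \<mu> K" using U_1 by simp
  then show ?thesis by (simp add: LIMSEQ_const_iff)
qed

lemma cube_pos: "w \<in> W \<Longrightarrow> 0 < measure \<mu> (Q w)"
  by (rule cube_measure_pos) (simp_all add: measure_K)

lemma AE_in_K: "AE x in \<mu>. x \<in> K"
proof (rule AE_I)
  have "measure \<mu> (space \<mu> - K) = 0"
    using finite_measure_compl[of K] measure_K measure_mu_UNIV borel_compact[OF compact_K] by simp
  then show "emeasure \<mu> (- K) = 0"
    by (simp add: emeasure_eq_measure Compl_eq_Diff_UNIV)
qed (use borel_compact[OF compact_K] in auto)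

text \<open>The points of maximal mass, if there are atoms at all, form a finite set \<open>A\<close>. Invariance writes the mass
  of a point as a weighted mean of the masses of its preimages, so maximality forces every point of \<open>A\<close> to
  have, under each \<open>S i\<close>, a preimage in \<open>A\<close>. As \<open>S 1\<close> is a contraction, \<open>A\<close> has diameter \<open>0\<close>: its only point is fixed by
  all maps, which is excluded.\<close>

lemma no_atoms: "measure \<mu> {x} = 0"
proof (rule ccontr)
  assume x: "measure \<mu> {x} \<noteq> 0"
  define c where "c = measure \<mu> {x}"
  have c: "0 < c" using x unfolding c_def by (simp add: order_less_le)
  define B where "B = {y. c \<le> measure \<mu> {y}}"
  have card_B: "card F \<le> nat \<lfloor>1 / c\<rfloor>" if F: "F \<subseteq> B" "finite F" for F
  proof -
    have "real (card F) * c \<le> (\<Sum>y\<in>F. measure \<mu> {y})"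
      using F by (intro sum_bounded_below) (auto simp: B_def)
    also have "\<dots> = measure \<mu> F"
      using F by (intro finite_measure_eq_sum_singleton[symmetric]) auto
    also have "\<dots> \<le> 1" by (rule measure_mu_le_1)
    finally have "real (card F) \<le> 1 / c" using c by (simp add: field_simps)
    then show ?thesis by linarith
  qed
  have "finite B"
    by (rule conjunct1[OF finite_if_finite_subsets_card_bdd[OF card_B]])
  define a where "a = Max ((\<lambda>y. measure \<mu> {y}) ` B)"
  define A where "A = {y. measure \<mu> {y} = a}"
  have "x \<in> B" by (simp add: B_def c_def)
  then have "c \<le> a" "a \<in> (\<lambda>y. measure \<mu> {y}) ` B"
    unfolding a_def using \<open>finite B\<close> by (auto simp: c_def intro!: Max_ge Max_in)
  have le_a: "measure \<mu> {y} \<le> a" for y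
  proof (cases "y \<in> B")
    case True
    then show ?thesis unfolding a_def using \<open>finite B\<close> by (intro Max_ge) auto
  qed (use \<open>c \<le> a\<close> in \<open>simp add: B_def\<close>)
  have "A \<subseteq> B" using \<open>c \<le> a\<close> by (auto simp: A_def B_def)
  then have "finite A" using \<open>finite B\<close> finite_subset by blast
  have "A \<noteq> {}" using \<open>a \<in> _\<close> by (auto simp: A_def)
  have preimage: "\<exists>y'\<in>A. S i y' = y" if y: "y \<in> A" and i: "i \<in> {1..m}" for y i
  proof (rule ccontr)
    assume none: "\<not> (\<exists>y'\<in>A. S i y' = y)"
    have le: "measure \<mu> (S j -` {y}) \<le> a \<and> (j = i \<longrightarrow> measure \<mu> (S j -` {y}) < a)"
      if j: "j \<in> {1..m}" for j
    proof (cases "S j -` {y} = {}")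
      case False
      then obtain y' where y': "S j y' = y" by auto
      then have "S j -` {y} = {y'}" using inj_S[OF j] by (auto dest: injD)
      then show ?thesis using le_a[of y'] none y' by (auto simp: A_def order_less_le)
    qed (use \<open>c \<le> a\<close> c in auto)
    have "a = (\<Sum>j=1..m. q j * measure \<mu> (S j -` {y}))"
      using y measure_mu_eq[of "{y}"] by (simp add: A_def)
    also have "\<dots> < (\<Sum>j=1..m. q j * a)"
      using le q_pos i by (intro sum_strict_mono_ex1) (auto intro!: mult_left_mono bexI[of _ i] simp: less_imp_le)
    also have "\<dots> = a" using q_sum by (simp flip: sum_distrib_right)
    finally show False by simp
  qed
  have unique: "y = z" if yz: "y \<in> A" "z \<in> A" for y z
  proof -
    obtain r where r: "0 < r" "r < 1"
      and S: "\<And>i x y. i \<in> {1..m} \<Longrightarrow> dist (S i x) (S i y) \<le> r * dist x y"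
      by (rule uniform_ratio) blast
    define D where "D = Max ((\<lambda>(y, z). dist y z) ` (A \<times> A))"
    have D_ge: "dist y z \<le> D" if "y \<in> A" "z \<in> A" for y z
      unfolding D_def using that \<open>finite A\<close> by (intro Max_ge) auto
    have "D \<in> (\<lambda>(y, z). dist y z) ` (A \<times> A)"
      unfolding D_def using \<open>finite A\<close> \<open>A \<noteq> {}\<close> by (intro Max_in) auto
    then obtain u v where uv: "u \<in> A" "v \<in> A" "D = dist u v" by auto
    \<comment> \<open>Any one of the maps will do to contract a pair at maximal distance.\<close>
    have 1: "1 \<in> {1..m}" using m_pos by simp
    obtain u' v' where "u' \<in> A" "v' \<in> A" "S 1 u' = u" "S 1 v' = v"
      using preimage[OF _ 1] uv by metis
    then have "D \<le> r * D"
      using S[OF 1, of u' v'] D_ge[of u' v'] uv r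
      by (metis dual_order.trans mult_le_cancel_left_pos)
    then have "D * (1 - r) \<le> 0" by (simp add: algebra_simps)
    then have "D \<le> 0" using r by (simp add: mult_le_0_iff)
    then have "dist y z \<le> 0" using D_ge[OF yz] by linarith
    then show ?thesis by simp
  qed
  obtain y where "y \<in> A" using \<open>A \<noteq> {}\<close> by auto
  have "S i y = y" if i: "i \<in> {1..m}" for i
  proof -
    obtain y' where "y' \<in> A" "S i y' = y" using preimage[OF \<open>y \<in> A\<close> i] by (rule bexE)
    then show ?thesis using unique[OF \<open>y' \<in> A\<close> \<open>y \<in> A\<close>] by simp
  qed
  then show False using no_common_fixpoint by blast
qed

lemma finite_imp_null:
  assumes "finite A"
  shows "A \<in> null_sets \<mu>"
proof -
  have "A \<in> sets borel" using assms by (intro borel_closed finite_imp_closed)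
  moreover have "measure \<mu> A = 0"
    using finite_measure_eq_sum_singleton[OF assms] by (simp add: no_atoms)
  ultimately show ?thesis by (simp add: null_sets_def emeasure_eq_measure)
qed

lemma cube_dist_small:
  assumes "0 < e"
  obtains n where "\<And>w x y. w \<in> W \<Longrightarrow> n \<le> length w \<Longrightarrow> x \<in> Q w \<Longrightarrow> y \<in> Q w \<Longrightarrow> dist x y < e"
proof -
  obtain r where r: "0 < r" "r < 1"
    and S: "\<And>i x y. i \<in> {1..m} \<Longrightarrow> dist (S i x) (S i y) \<le> r * dist x y"
    by (rule uniform_ratio) blast
  obtain D where D: "0 < D" "\<And>x y. x \<in> K \<Longrightarrow> y \<in> K \<Longrightarrow> dist x y \<le> D"
  proof
    show "dist x y \<le> diameter K + 1" if "x \<in> K" "y \<in> K" for x y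
      using diameter_bounded_bound[OF compact_imp_bounded[OF compact_K] that] by simp
    show "0 < diameter K + 1"
      using diameter_ge_0[OF compact_imp_bounded[OF compact_K]] by simp
  qed
  have bound: "dist x y \<le> r ^ length w * D" if "w \<in> W" "x \<in> Q w" "y \<in> Q w" for w x y
    using that
  proof (induction w arbitrary: x y)
    case (Cons i w)
    then obtain x' y' where xy: "x' \<in> Q w" "y' \<in> Q w" "x = S i x'" "y = S i y'"
      by (auto simp: cube_Cons)
    have i: "i \<in> {1..m}" by (rule Cons.hyps)
    have "dist x y \<le> r * dist x' y'" using S[OF i, of x' y'] xy by simp
    also have "\<dots> \<le> r * (r ^ length w * D)"
      using Cons xy r by (intro mult_left_mono) auto
    finally show ?case by (simp add: mult.assoc)
  qed (simp add: D)
  obtain n where n: "r ^ n < e / D"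
    using real_arch_pow_inv[of "e / D" r] r D assms by auto
  show thesis
  proof (rule that)
    fix w x y assume w: "w \<in> W" "n \<le> length w" "x \<in> Q w" "y \<in> Q w"
    have "dist x y \<le> r ^ length w * D" using bound w by simp
    also have "\<dots> \<le> r ^ n * D"
      using w r D by (intro mult_right_mono power_decreasing) auto
    also have "\<dots> < e" using n D by (simp add: field_simps)
    finally show "dist x y < e" .
  qed
qed

lemma sequences_words: "\<omega> \<in> sequences m \<Longrightarrow> map \<omega> [0..<n] \<in> W"
  by (auto simp: sequences_def)

lemma exists_coding:
  assumes "x \<in> K"
  obtains \<omega> where "\<omega> \<in> sequences m" "\<And>n. x \<in> Q (map \<omega> [0..<n])"
proof -
  have "\<forall>y\<in>K. \<exists>i z. i \<in> {1..m} \<and> z \<in> K \<and> y = S i z"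
    by (subst K_eq) blast
  then obtain I Z where IZ: "\<And>y. y \<in> K \<Longrightarrow> I y \<in> {1..m} \<and> Z y \<in> K \<and> y = S (I y) (Z y)"
    by metis
  define z where "z n = (Z ^^ n) x" for n
  define \<omega> where "\<omega> n = I (z n)" for n
  have z: "z n \<in> K" for n
    by (induction n) (use assms IZ in \<open>auto simp: z_def\<close>)
  have "x = word_map S (map \<omega> [0..<n]) (z n)" for n
  proof (induction n)
    case (Suc n)
    have "z n = S (\<omega> n) (z (Suc n))" using IZ[OF z[of n]] by (simp add: \<omega>_def z_def)
    then show ?case using Suc by (simp add: word_map_append)
  qed (simp add: z_def)
  then have "x \<in> Q (map \<omega> [0..<n])" for n
    using z unfolding cube_def by blast
  moreover have "\<omega> \<in> sequences m" using IZ z by (simp add: sequences_def \<omega>_def)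
  ultimately show thesis using that by blast
qed

lemma coding_map_eqI:
  assumes \<omega>: "\<omega> \<in> sequences m" and x: "\<And>n. x \<in> Q (map \<omega> [0..<n])"
  shows "coding_map S K \<omega> = x"
proof -
  have "y = x" if y: "\<And>n. 1 \<le> n \<Longrightarrow> y \<in> Q (map \<omega> [0..<n])" for y
  proof (rule ccontr)
    assume "y \<noteq> x"
    then obtain n where n: "\<And>w a b. w \<in> W \<Longrightarrow> n \<le> length w \<Longrightarrow> a \<in> Q w \<Longrightarrow> b \<in> Q w \<Longrightarrow> dist a b < dist y x"
      using cube_dist_small[of "dist y x"] by auto
    show False
      using n[OF sequences_words[OF \<omega>, of "Suc n"] _ y[of "Suc n"] x[of "Suc n"]] by simp
  qed
  then have "(\<Inter>n\<in>{1..}. Q (map \<omega> [0..<n])) = {x}"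
    using x by auto
  then show ?thesis by (simp add: coding_map_def)
qed

end


section \<open>Null overlaps of post-critically finite sets\<close>

locale pcf_system = self_similar_system +
  assumes pcf: "post_critically_finite m S K"
begin

text \<open>A sequence is determined by its first letter and its shift, so finiteness of the shifted critical set makes
  the critical set itself finite; it codes all points of the overlap set.\<close>

lemma finite_overlap_set: "finite (overlap_set m S K)"
proof -
  define C where "C = critical_set m S K"
  have "finite ((shift ^^ 1) ` C)"
    using pcf unfolding post_critically_finite_def C_def[symmetric]
    by (rule finite_subset[rotated]) force
  then have fin: "finite (shift ` C)" by simp
  have "C \<subseteq> (\<lambda>(i, \<omega>) n. case n of 0 \<Rightarrow> i | Suc k \<Rightarrow> \<omega> k) ` ({1..m} \<times> shift ` C)"
  proof
    fix \<omega> assume \<omega>: "\<omega> \<in> C"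
    then have "\<omega> 0 \<in> {1..m}" by (auto simp: C_def critical_set_def sequences_def)
    moreover have "\<omega> = (\<lambda>n. case n of 0 \<Rightarrow> \<omega> 0 | Suc k \<Rightarrow> shift \<omega> k)"
      by (auto simp: shift_def split: nat.split)
    ultimately show "\<omega> \<in> (\<lambda>(i, \<omega>) n. case n of 0 \<Rightarrow> i | Suc k \<Rightarrow> \<omega> k) ` ({1..m} \<times> shift ` C)"
      using \<omega> by (intro image_eqI[of _ _ "(\<omega> 0, shift \<omega>)"]) auto
  qed
  then have "finite C" using fin finite_subset by blast
  moreover have "overlap_set m S K \<subseteq> coding_map S K ` C"
  proof
    fix x assume x: "x \<in> overlap_set m S K"
    then have "x \<in> K" by (subst K_eq) (auto simp: overlap_set_def)
    then obtain \<omega> where "\<omega> \<in> sequences m" "\<And>n. x \<in> Q (map \<omega> [0..<n])"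
      using exists_coding by blast
    then have "\<omega> \<in> C" "coding_map S K \<omega> = x"
      using coding_map_eqI[of \<omega> x] x by (auto simp: C_def critical_set_def)
    then show "x \<in> coding_map S K ` C" by blast
  qed
  ultimately show ?thesis using finite_subset by blast
qed

text \<open>After removal of the longest common prefix the two words start with different letters, so the
  intersection is an injective image of a subset of the overlap set.\<close>

lemma parallel_cubes_null:
  assumes "parallel u v" "u \<in> W" "v \<in> W"
  shows "Q u \<inter> Q v \<in> null_sets \<mu>"
proof -
  obtain p i u' j v' where ij: "i \<noteq> j" and uv: "u = p @ i # u'" "v = p @ j # v'"
    using parallel_decomp[OF assms(1)] by blast
  have W: "p \<in> W" "i # u' \<in> W" "j # v' \<in> W" using assms uv by auto
  have "inj (word_map S p)"
    using \<open>p \<in> W\<close>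
  proof (induction p)
    case (Cons i w)
    then show ?case unfolding word_map_Cons by (intro inj_compose inj_S)
  qed simp
  then have "Q u \<inter> Q v = word_map S p ` (Q (i # u') \<inter> Q (j # v'))"
    by (simp add: uv cube_append image_Int)
  also have "\<dots> \<subseteq> word_map S p ` overlap_set m S K"
  proof (rule image_mono)
    have "Q (i # u') \<subseteq> S i ` K" "Q (j # v') \<subseteq> S j ` K"
      using W cube_subset_K by (auto simp: cube_Cons)
    then have "Q (i # u') \<inter> Q (j # v') \<subseteq> S i ` K \<inter> S j ` K" by blast
    also have "\<dots> \<subseteq> overlap_set m S K"
      using ij W(2,3) unfolding overlap_set_def lists.simps[of "_ # _"] by blast
    finally show "Q (i # u') \<inter> Q (j # v') \<subseteq> overlap_set m S K" .
  qed
  finally have "finite (Q u \<inter> Q v)"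
    using finite_overlap_set by (meson finite_imageI finite_subset)
  then show ?thesis by (rule finite_imp_null)
qed

text \<open>One null set outside of which cubes behave like the cylinders of the tree of words.\<close>

lemma overlap_null_set:
  obtains N where "N \<in> null_sets \<mu>"
    "\<And>u v. u \<in> W \<Longrightarrow> v \<in> W \<Longrightarrow> parallel u v \<Longrightarrow> Q u \<inter> Q v \<subseteq> N"
proof -
  define I where "I = {(u, v). u \<in> W \<and> v \<in> W \<and> parallel u v}"
  have "(\<Union>(u, v)\<in>I. Q u \<inter> Q v) \<in> null_sets \<mu>"
    by (rule null_sets_UN') (auto simp: I_def intro!: parallel_cubes_null)
  then show thesis by (rule that) (auto simp: I_def)
qed


section \<open>The maximal function\<close>

abbreviation M :: "('a \<Rightarrow> real) \<Rightarrow> 'a \<Rightarrow> ennreal" where "M \<equiv> maximal_function m S K \<mu>"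

lemma emeasure_cube: "emeasure \<mu> (Q v) = ennreal (measure \<mu> (Q v))"
  by (rule emeasure_eq_measure)

lemma average_times_measure: "v \<in> W \<Longrightarrow> X / emeasure \<mu> (Q v) * emeasure \<mu> (Q v) = X"
  using cube_pos[of v] by (simp add: ennreal_divide_times emeasure_cube)

lemma maximal_function_eq:
  "M f x = (SUP v\<in>{v \<in> W - {[]}. x \<in> Q v}.
    (\<integral>\<^sup>+y\<in>Q v. ennreal \<bar>f y\<bar> \<partial>\<mu>) / emeasure \<mu> (Q v))"
  unfolding maximal_function_def Union_words_nonempty nn_integral_completion ..

lemma average_le_maximal:
  assumes "v \<in> W" "v \<noteq> []" "x \<in> Q v"
  shows "(\<integral>\<^sup>+y\<in>Q v. ennreal \<bar>f y\<bar> \<partial>\<mu>) / emeasure \<mu> (Q v) \<le> M f x"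
  unfolding maximal_function_eq using assms by (intro SUP_upper) auto

lemma maximal_function_cong:
  assumes "AE x in \<mu>. f x = g x"
  shows "M f = M g"
proof -
  have "(\<integral>\<^sup>+y\<in>Q v. ennreal \<bar>f y\<bar> \<partial>\<mu>) = (\<integral>\<^sup>+y\<in>Q v. ennreal \<bar>g y\<bar> \<partial>\<mu>)" for v
    using assms by (intro nn_integral_cong_AE) auto
  then show ?thesis by (simp add: maximal_function_eq fun_eq_iff)
qed

lemma maximal_function_borel: "M f \<in> borel_measurable \<mu>"
proof -
  let ?A = "\<lambda>v. (\<integral>\<^sup>+y\<in>Q v. ennreal \<bar>f y\<bar> \<partial>\<mu>) / emeasure \<mu> (Q v)"
  have "M f x = (SUP v\<in>W - {[]}. ?A v * indicator (Q v) x)" for x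
  proof (rule antisym)
    show "M f x \<le> (SUP v\<in>W - {[]}. ?A v * indicator (Q v) x)"
      unfolding maximal_function_eq
    proof (rule SUP_least)
      fix v assume "v \<in> {v \<in> W - {[]}. x \<in> Q v}"
      then show "?A v \<le> (SUP v\<in>W - {[]}. ?A v * indicator (Q v) x)"
        by (intro SUP_upper2[of v]) auto
    qed
    show "(SUP v\<in>W - {[]}. ?A v * indicator (Q v) x) \<le> M f x"
      using average_le_maximal by (intro SUP_least) (auto split: split_indicator)
  qed
  moreover have "(\<lambda>x. SUP v\<in>W - {[]}. ?A v * indicator (Q v) x) \<in> borel_measurable \<mu>"
    by (intro borel_measurable_SUP) auto
  ultimately show ?thesis by (simp cong: measurable_cong)
qed

text \<open>The mass bound \<open>\<integral>\<bar>f\<bar> \<le> b \<mu>(Q v)\<close> holds on each cube \<open>Q v\<close> that meets \<open>A\<close>. An open set \<open>U\<close> containing \<open>A\<close>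
  contains an almost disjoint union of such cubes that covers \<open>A\<close>, namely the cubes of the shortest words
  with both properties. Summing up, \<open>a \<mu>(A) \<le> \<integral>\<^sub>A \<bar>f\<bar> \<le> b \<mu>(U)\<close>, and outer regularity yields
  \<open>a \<mu>(A) \<le> b \<mu>(A)\<close>.\<close>

lemma maximal_function_ge_null:
  fixes a b :: real
  assumes f [measurable]: "f \<in> borel_measurable \<mu>" and A [measurable]: "A \<in> sets borel" and "A \<subseteq> K"
    and fA: "\<And>x. x \<in> A \<Longrightarrow> a \<le> \<bar>f x\<bar>" and MA: "\<And>x. x \<in> A \<Longrightarrow> M f x \<le> ennreal b"
    and ab: "0 \<le> b" "b < a"
  shows "emeasure \<mu> A = 0"
proof -
  define \<nu> where "\<nu> = density \<mu> (\<lambda>x. ennreal \<bar>f x\<bar>)"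
  have sets_\<nu>: "sets \<nu> = sets \<mu>" by (simp add: \<nu>_def)
  obtain N where N: "N \<in> null_sets \<mu>"
    and N_overlap: "\<And>u v. u \<in> W \<Longrightarrow> v \<in> W \<Longrightarrow> parallel u v \<Longrightarrow> Q u \<inter> Q v \<subseteq> N"
    using overlap_null_set by blast
  have N_sets [measurable]: "N \<in> sets borel" using N by auto
  have le_open: "ennreal a * emeasure \<mu> A \<le> ennreal b * emeasure \<mu> U" if U: "A \<subseteq> U" "open U" for U
  proof -
    define P where "P v \<longleftrightarrow> v \<in> W \<and> v \<noteq> [] \<and> Q v \<subseteq> U \<and> Q v \<inter> A \<noteq> {}" for v
    define V where "V = {v. P v \<and> (\<forall>w. strict_prefix w v \<longrightarrow> \<not> P w)}"
    have V_W: "V \<subseteq> W" by (auto simp: V_def P_def)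
    have [measurable]: "v \<in> V \<Longrightarrow> Q v \<in> sets borel" for v using V_W cube_borel by blast
    have cover: "A \<subseteq> (\<Union>v\<in>V. Q v)"
    proof
      fix x assume x: "x \<in> A"
      then obtain \<omega> where \<omega>: "\<omega> \<in> sequences m" "\<And>n. x \<in> Q (map \<omega> [0..<n])"
        using \<open>A \<subseteq> K\<close> exists_coding by blast
      obtain e where e: "0 < e" "ball x e \<subseteq> U"
        using U x open_contains_ball by blast
      obtain n where n: "\<And>w x y. w \<in> W \<Longrightarrow> n \<le> length w \<Longrightarrow> x \<in> Q w \<Longrightarrow> y \<in> Q w \<Longrightarrow> dist x y < e"
        using cube_dist_small[OF e(1)] by blast
      define v where "v = map \<omega> [0..<Suc n]"
      have v: "v \<in> W" "v \<noteq> []" "x \<in> Q v" "n \<le> length v"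
        using sequences_words[OF \<omega>(1)] \<omega>(2) by (auto simp: v_def simp del: upt_Suc)
      have "Q v \<subseteq> ball x e" using n[OF v(1) v(4) v(3)] by auto
      then have "P v" using v e(2) x by (auto simp: P_def)
      then obtain u where u: "prefix u v" "P u" "\<And>w. strict_prefix w u \<Longrightarrow> \<not> P w"
        using minimal_prefix[of P v] by blast
      then have "u \<in> V" by (auto simp: V_def)
      moreover have "x \<in> Q u" using cube_antimono[OF u(1) v(1)] v(3) by auto
      ultimately show "x \<in> (\<Union>v\<in>V. Q v)" by blast
    qed
    have disj: "disjoint_family_on (\<lambda>v. Q v - N) V"
      unfolding disjoint_family_on_def
    proof (intro ballI impI)
      fix u v assume uv: "u \<in> V" "v \<in> V" "u \<noteq> v"
      then have "parallel u v"
        unfolding V_def parallel_def by (auto simp: strict_prefix_def)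
      then show "(Q u - N) \<inter> (Q v - N) = {}" using N_overlap uv V_W by blast
    qed
    have local_bound: "emeasure \<nu> (Q v - N) \<le> ennreal b * emeasure \<mu> (Q v - N)"
      if v: "v \<in> V" for v
    proof -
      obtain x where x: "x \<in> Q v" "x \<in> A" using v by (auto simp: V_def P_def)
      have v': "v \<in> W" "v \<noteq> []" using v by (auto simp: V_def P_def)
      have "emeasure \<nu> (Q v - N) \<le> emeasure \<nu> (Q v)"
        using v by (intro emeasure_mono) (auto simp: sets_\<nu>)
      also have "\<dots> = (\<integral>\<^sup>+y\<in>Q v. ennreal \<bar>f y\<bar> \<partial>\<mu>) / emeasure \<mu> (Q v) * emeasure \<mu> (Q v)"
        using v v' by (simp add: average_times_measure \<nu>_def emeasure_density)
      also have "\<dots> \<le> ennreal b * emeasure \<mu> (Q v)"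
        using average_le_maximal[OF v' x(1), of f] MA[OF x(2)] by (intro mult_right_mono) auto
      also have "emeasure \<mu> (Q v) = emeasure \<mu> (Q v - N)"
        using N v by (simp add: emeasure_Diff_null_set)
      finally show ?thesis .
    qed
    have "ennreal a * emeasure \<mu> A = ennreal a * emeasure \<mu> (A - N)"
      by (simp add: emeasure_Diff_null_set N A)
    also have "\<dots> = (\<integral>\<^sup>+x. ennreal a * indicator (A - N) x \<partial>\<mu>)"
      by (rule nn_integral_cmult_indicator[symmetric]) measurable
    also have "\<dots> \<le> emeasure \<nu> (A - N)"
      unfolding \<nu>_def using fA
      by (subst emeasure_density) (auto intro!: nn_integral_mono split: split_indicator)
    also have "\<dots> \<le> emeasure \<nu> (\<Union>v\<in>V. Q v - N)"
      using cover V_W by (intro emeasure_mono) (auto simp: sets_\<nu>)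
    also have "\<dots> = (\<integral>\<^sup>+v. emeasure \<nu> (Q v - N) \<partial>count_space V)"
      by (intro emeasure_UN_countable disj) (auto simp: sets_\<nu>)
    also have "\<dots> \<le> (\<integral>\<^sup>+v. ennreal b * emeasure \<mu> (Q v - N) \<partial>count_space V)"
      using local_bound by (intro nn_integral_mono) auto
    also have "\<dots> = ennreal b * emeasure \<mu> (\<Union>v\<in>V. Q v - N)"
      by (subst emeasure_UN_countable) (auto simp: disj nn_integral_cmult)
    also have "\<dots> \<le> ennreal b * emeasure \<mu> U"
      using U by (intro mult_left_mono emeasure_mono) (auto simp: V_def P_def)
    finally show ?thesis .
  qed
  have regular: "emeasure \<mu> A = (INF U\<in>{U. A \<subseteq> U \<and> open U}. emeasure \<mu> U)"
    using A by (intro outer_regular) (auto simp: emeasure_mu_UNIV)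
  have "ennreal a * emeasure \<mu> A \<le> ennreal b * emeasure \<mu> A"
  proof (cases "b = 0")
    case True
    then show ?thesis using le_open[of UNIV] by simp
  next
    case False
    then have b: "0 < b" using ab by simp
    have "ennreal (a / b) * emeasure \<mu> A \<le> emeasure \<mu> U" if "A \<subseteq> U" "open U" for U
    proof -
      have "ennreal (1 / b) * (ennreal a * emeasure \<mu> A) \<le> ennreal (1 / b) * (ennreal b * emeasure \<mu> U)"
        using le_open[OF that] by (rule mult_left_mono) simp
      then show ?thesis
        using b ab by (simp add: mult.assoc[symmetric] ennreal_mult[symmetric])
    qed
    then have "ennreal (a / b) * emeasure \<mu> A \<le> emeasure \<mu> A"
      by (subst (2) regular) (auto intro: INF_greatest)
    then have "ennreal b * (ennreal (a / b) * emeasure \<mu> A) \<le> ennreal b * emeasure \<mu> A"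
      by (rule mult_left_mono) simp
    then show ?thesis
      using b ab by (simp add: mult.assoc[symmetric] ennreal_mult[symmetric])
  qed
  then have "a * measure \<mu> A \<le> b * measure \<mu> A"
    using ab by (simp add: emeasure_eq_measure ennreal_mult[symmetric])
  then have "measure \<mu> A = 0"
    using ab measure_nonneg[of \<mu> A] by (auto simp: mult_le_cancel_right)
  then show ?thesis by (simp add: emeasure_eq_measure)
qed

text \<open>If \<open>M f x < \<bar>f x\<bar>\<close>, two rationals fit in between; each pair of rationals accounts for a null set only. The
  sets become Borel after passing to a Borel version of \<open>f\<close>, which has the same maximal function.\<close>

lemma AE_le_maximal_function:
  assumes f: "f \<in> borel_measurable (completion \<mu>)"
  shows "AE x in \<mu>. ennreal \<bar>f x\<bar> \<le> M f x"
proof -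
  obtain g where g [measurable]: "g \<in> borel_measurable \<mu>" and fg: "AE x in \<mu>. f x = g x"
    using completion_ex_borel_measurable_real[OF f] by blast
  have [measurable]: "M g \<in> borel_measurable \<mu>" by (rule maximal_function_borel)
  have [measurable]: "K \<in> sets \<mu>" using borel_compact[OF compact_K] by simp
  define A where "A a b = {x \<in> K. real_of_rat a \<le> \<bar>g x\<bar> \<and> M g x \<le> ennreal (real_of_rat b)}" for a b
  have "AE x in \<mu>. x \<notin> A a b" if "0 \<le> b" "b < a" for a b
  proof -
    have "A a b = {x \<in> space \<mu>. x \<in> K \<and> real_of_rat a \<le> \<bar>g x\<bar> \<and> M g x \<le> ennreal (real_of_rat b)}"
      by (simp add: A_def)
    also have "\<dots> \<in> sets \<mu>" by measurable
    finally have sets: "A a b \<in> sets borel" by simp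
    have "emeasure \<mu> (A a b) = 0"
      using that by (intro maximal_function_ge_null[of g _ "real_of_rat a" "real_of_rat b"])
        (auto simp: A_def of_rat_less sets)
    then show ?thesis using sets by (intro AE_not_in null_setsI) simp_all
  qed
  then have "AE x in \<mu>. \<forall>a b. 0 \<le> b \<and> b < a \<longrightarrow> x \<notin> A a b"
    by (simp add: AE_all_countable)
  then have "AE x in \<mu>. ennreal \<bar>g x\<bar> \<le> M g x"
    using AE_in_K
  proof eventually_elim
    case (elim x)
    show ?case
    proof (rule ccontr)
      assume "\<not> ennreal \<bar>g x\<bar> \<le> M g x"
      then have less: "M g x < ennreal \<bar>g x\<bar>" by simp
      then obtain c where c: "M g x = ennreal c" "0 \<le> c"
        by (cases "M g x") auto
      then have "c < \<bar>g x\<bar>" using less by (simp add: ennreal_less_iff)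
      then obtain b where b: "c < real_of_rat b" "real_of_rat b < \<bar>g x\<bar>" using of_rat_dense by blast
      then obtain a where a: "real_of_rat b < real_of_rat a" "real_of_rat a < \<bar>g x\<bar>" using of_rat_dense by blast
      have "0 \<le> b" "b < a" using a b c by (auto simp: of_rat_less intro: order_trans less_imp_le) (metis less_imp_le of_rat_less_eq of_rat_0 order.trans)
      moreover have "x \<in> A a b" using a b c elim by (auto simp: A_def intro!: ennreal_leI)
      ultimately show False using elim by blast
    qed
  qed
  then show ?thesis
    using fg unfolding maximal_function_cong[OF fg] by eventually_elim simp
qed

end


section \<open>The content as a cost of word sets\<close>

lemma nn_integral_count_space_eq_set:
  "(\<integral>\<^sup>+x. f x \<partial>count_space A) = (\<integral>\<^sup>+x\<in>A. f x \<partial>count_space UNIV)"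
  by (cases "A = UNIV") (simp_all add: nn_integral_count_space_indicator)

locale content_system = pcf_system +
  fixes \<alpha> :: real
  assumes alpha_pos: "0 < \<alpha>" and alpha_le: "\<alpha> \<le> hausdorff_dim K"
begin

definition \<beta> :: real where "\<beta> = \<alpha> / hausdorff_dim K"

lemma beta: "0 < \<beta>" "\<beta> \<le> 1"
  using alpha_pos alpha_le by (auto simp: \<beta>_def)

abbreviation H :: "'a set \<Rightarrow> ennreal" where "H \<equiv> cube_content m S K \<mu> \<alpha>"

text \<open>A cover by cubes is recorded by the set of its words. Words, unlike cubes, form a tree even where different
  words name the same cube.\<close>

definition cost :: "nat list set \<Rightarrow> ennreal" where
  "cost A = (\<integral>\<^sup>+w\<in>A. ennreal (measure \<mu> (Q w) powr \<beta>) \<partial>count_space UNIV)"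

lemma cost_eq: "cost A = (\<integral>\<^sup>+w. ennreal (measure \<mu> (Q w) powr \<beta>) \<partial>count_space A)"
  unfolding cost_def by (rule nn_integral_count_space_eq_set[symmetric])

lemma cost_Un: "cost (A \<union> B) \<le> cost A + cost B"
  unfolding cost_def
  by (subst nn_integral_add[symmetric]) (auto intro!: nn_integral_mono split: split_indicator)

lemma cost_UN: "cost (\<Union>j::nat. A j) \<le> (\<Sum>j. cost (A j))"
proof -
  have "indicator (\<Union>j. A j) w \<le> (\<Sum>j. indicator (A j) w :: ennreal)" for w
  proof (cases "w \<in> (\<Union>j. A j)")
    case True
    then obtain j where j: "w \<in> A j" by blast
    have "(1::ennreal) = (\<Sum>k\<in>{j}. indicator (A k) w)" using j by simp
    also have "\<dots> \<le> (\<Sum>k. indicator (A k) w)" by (intro sum_le_suminf) auto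
    finally show ?thesis using True by simp
  qed simp
  then have "cost (\<Union>j. A j) \<le>
      (\<integral>\<^sup>+w. ennreal (measure \<mu> (Q w) powr \<beta>) * (\<Sum>j. indicator (A j) w) \<partial>count_space UNIV)"
    unfolding cost_def by (intro nn_integral_mono mult_left_mono) auto
  also have "\<dots> = (\<Sum>j. cost (A j))"
    unfolding cost_def by (simp add: nn_integral_suminf flip: ennreal_suminf_cmult)
  finally show ?thesis .
qed

lemma content_le_cost:
  assumes "A \<subseteq> W" "E \<subseteq> (\<Union>w\<in>A. Q w)"
  shows "H E \<le> cost A"
proof -
  define I where "I n = (if n \<in> to_nat ` A then Q (from_nat n) else {})" for n
  have I_basic: "I n \<in> insert {} (basic_cubes m S K)" for n
    using assms(1) by (force simp: I_def basic_cubes_eq)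
  have "E \<subseteq> (\<Union>n. I n)"
  proof
    fix x assume "x \<in> E"
    then obtain w where "w \<in> A" "x \<in> Q w" using assms(2) by blast
    then have "x \<in> I (to_nat w)" by (simp add: I_def)
    then show "x \<in> (\<Union>n. I n)" by blast
  qed
  then have "H E \<le> (\<Sum>n. ennreal (measure \<mu> (I n) powr \<beta>))"
    unfolding cube_content_def \<beta>_def using I_basic by (intro INF_lower) auto
  also have "\<dots> = (\<integral>\<^sup>+n. ennreal (measure \<mu> (I n) powr \<beta>) \<partial>count_space UNIV)"
    by (rule nn_integral_count_space_nat[symmetric])
  also have "\<dots> = (\<integral>\<^sup>+n. ennreal (measure \<mu> (Q (from_nat n)) powr \<beta>) * indicator (to_nat ` A) n \<partial>count_space UNIV)"
    by (intro nn_integral_cong) (auto simp: I_def split: split_indicator)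
  also have "\<dots> = (\<integral>\<^sup>+n. ennreal (measure \<mu> (Q (from_nat n)) powr \<beta>) \<partial>count_space (to_nat ` A))"
    by (rule nn_integral_count_space_eq_set[symmetric])
  also have "\<dots> = (\<integral>\<^sup>+w. ennreal (measure \<mu> (Q (from_nat (to_nat w))) powr \<beta>) \<partial>count_space A)"
    by (rule nn_integral_bij_count_space[symmetric]) (auto simp: bij_betw_def intro: inj_on_subset[OF inj_to_nat])
  finally show ?thesis by (simp add: cost_eq)
qed

lemma content_lessE:
  assumes "H E < c"
  obtains I :: "nat \<Rightarrow> 'a set" where "\<And>j. I j \<in> insert {} (basic_cubes m S K)" "E \<subseteq> (\<Union>j. I j)"
    "(\<Sum>j. ennreal (measure \<mu> (I j) powr \<beta>)) < c"
  using assms unfolding cube_content_def INF_less_iff \<beta>_def by blast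

lemma content_cover:
  assumes "H E < c"
  obtains A where "A \<subseteq> W" "E \<subseteq> (\<Union>w\<in>A. Q w)" "cost A < c"
proof -
  obtain I :: "nat \<Rightarrow> 'a set" where I: "\<And>j. I j \<in> insert {} (basic_cubes m S K)"
    and E: "E \<subseteq> (\<Union>j. I j)" and c: "(\<Sum>j. ennreal (measure \<mu> (I j) powr \<beta>)) < c"
    using content_lessE[OF assms] by blast
  define J where "J = {j. I j \<noteq> {}}"
  have "\<forall>j\<in>J. \<exists>w\<in>W. I j = Q w" using I unfolding J_def basic_cubes_eq by blast
  then obtain w where w: "\<And>j. j \<in> J \<Longrightarrow> w j \<in> W \<and> I j = Q (w j)" by metis
  show thesis
  proof (rule that)
    show "w ` J \<subseteq> W" using w by auto
    show "E \<subseteq> (\<Union>v\<in>w ` J. Q v)"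
    proof
      fix x assume "x \<in> E"
      then obtain j where "x \<in> I j" using E by blast
      moreover from this have "j \<in> J" by (auto simp: J_def)
      ultimately show "x \<in> (\<Union>v\<in>w ` J. Q v)" using w[of j] by auto
    qed
    \<comment> \<open>Several members of the cover may have received the same word; the word is charged to one of them.\<close>
    have "bij_betw (inv_into J w) (w ` J) (inv_into J w ` w ` J)"
      by (simp add: bij_betw_def inj_on_inv_into)
    then have "cost (w ` J) = (\<integral>\<^sup>+j. ennreal (measure \<mu> (Q (w j)) powr \<beta>) \<partial>count_space (inv_into J w ` w ` J))"
      unfolding cost_eq
      by (subst nn_integral_bij_count_space[symmetric]) (auto intro!: nn_integral_cong simp: f_inv_into_f)
    also have "\<dots> = (\<integral>\<^sup>+j. ennreal (measure \<mu> (I j) powr \<beta>) \<partial>count_space (inv_into J w ` w ` J))"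
      using w by (intro nn_integral_cong) (auto simp: inv_into_into)
    also have "\<dots> \<le> (\<integral>\<^sup>+j. ennreal (measure \<mu> (I j) powr \<beta>) \<partial>count_space UNIV)"
      unfolding nn_integral_count_space_eq_set[where A = "inv_into J w ` w ` J"]
      by (intro nn_integral_mono) (simp split: split_indicator)
    also have "\<dots> < c" using c by (simp add: nn_integral_count_space_nat)
    finally show "cost (w ` J) < c" .
  qed
qed

lemma content_mono: "E \<subseteq> F \<Longrightarrow> H E \<le> H F"
  unfolding cube_content_def by (intro INF_superset_mono) auto

lemma content_le_1: "E \<subseteq> K \<Longrightarrow> H E \<le> 1"
proof -
  assume "E \<subseteq> K"
  then have "H E \<le> cost {[]}" by (intro content_le_cost) auto
  also have "\<dots> = 1" by (simp add: cost_eq nn_integral_count_space_finite measure_K)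
  finally show ?thesis .
qed

text \<open>Measures are at most \<open>1\<close> and \<open>\<beta> \<le> 1\<close>, so \<open>\<mu>(I) \<le> \<mu>(I)\<^sup>\<beta>\<close> and a cheap cover has small measure.\<close>

lemma content_zero_imp_null:
  assumes "H E = 0"
  obtains N where "N \<in> null_sets \<mu>" "E \<subseteq> N"
proof -
  have "\<exists>B\<in>sets \<mu>. E \<subseteq> B \<and> emeasure \<mu> B \<le> ennreal (1 / real (Suc n))" for n
  proof -
    have "H E < ennreal (1 / real (Suc n))" using assms by simp
    from content_lessE[OF this] obtain I :: "nat \<Rightarrow> 'a set"
      where I: "\<And>j. I j \<in> insert {} (basic_cubes m S K)" and E: "E \<subseteq> (\<Union>j. I j)"
        and small: "(\<Sum>j. ennreal (measure \<mu> (I j) powr \<beta>)) < ennreal (1 / real (Suc n))"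
      by blast
    have sets: "I j \<in> sets \<mu>" for j
      using I[of j] unfolding basic_cubes_eq by (elim insertE imageE) (simp_all add: cube_borel)
    have "emeasure \<mu> (\<Union>j. I j) \<le> (\<Sum>j. emeasure \<mu> (I j))"
      using sets by (intro emeasure_subadditive_countably) auto
    also have "\<dots> \<le> (\<Sum>j. ennreal (measure \<mu> (I j) powr \<beta>))"
    proof (intro suminf_le summableI)
      fix j
      have "measure \<mu> (I j) \<le> measure \<mu> (I j) powr \<beta>"
        using powr_mono'[of \<beta> 1 "measure \<mu> (I j)"] beta measure_mu_le_1[of "I j"] by simp
      then show "emeasure \<mu> (I j) \<le> ennreal (measure \<mu> (I j) powr \<beta>)"
        by (simp add: emeasure_eq_measure ennreal_leI)
    qed
    finally have "emeasure \<mu> (\<Union>j. I j) \<le> ennreal (1 / real (Suc n))" using small by simp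
    with E sets show ?thesis by (intro bexI[of _ "\<Union>j. I j"]) auto
  qed
  then obtain B where B: "\<And>n. B n \<in> sets \<mu>" "\<And>n. E \<subseteq> B n"
    "\<And>n. emeasure \<mu> (B n) \<le> ennreal (1 / real (Suc n))"
    by metis
  have "measure \<mu> (\<Inter>n. B n) \<le> 1 / real (Suc n)" for n
  proof -
    have "emeasure \<mu> (\<Inter>n. B n) \<le> emeasure \<mu> (B n)"
      using B by (intro emeasure_mono) auto
    then have "emeasure \<mu> (\<Inter>n. B n) \<le> ennreal (1 / real (Suc n))" using B(3) order_trans by blast
    then show ?thesis by (simp add: emeasure_eq_measure del: of_nat_Suc)
  qed
  then have "measure \<mu> (\<Inter>n. B n) \<le> 0"
    using lim_1_over_n[THEN LIMSEQ_Suc] by (intro LIMSEQ_le_const) auto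
  then have "(\<Inter>n. B n) \<in> null_sets \<mu>"
    using B(1) by (intro null_setsI) (auto simp: emeasure_eq_measure measure_le_0_iff)
  then show thesis using B(2) by (intro that) auto
qed

end


section \<open>Content of the level sets of the maximal function\<close>

text \<open>An integral over a countable index set, as a series that the convergence theorems apply to.\<close>

lemma nn_integral_count_space_countable:
  fixes f :: "'i::countable \<Rightarrow> ennreal"
  shows "(\<integral>\<^sup>+i. f i \<partial>count_space UNIV) = (\<Sum>n. f (from_nat n) * indicator (range (to_nat :: 'i \<Rightarrow> nat)) n)"
proof -
  have "(\<integral>\<^sup>+i. f i \<partial>count_space UNIV) = (\<integral>\<^sup>+i. f (from_nat (to_nat (i :: 'i))) \<partial>count_space UNIV)"
    by simp
  also have "\<dots> = (\<integral>\<^sup>+n. f (from_nat n) \<partial>count_space (range (to_nat :: 'i \<Rightarrow> nat)))"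
    by (rule nn_integral_bij_count_space) (simp add: bij_betw_def)
  also have "\<dots> = (\<integral>\<^sup>+n. f (from_nat n) * indicator (range (to_nat :: 'i \<Rightarrow> nat)) n \<partial>count_space UNIV)"
    by (rule nn_integral_count_space_eq_set)
  finally show ?thesis by (simp only: nn_integral_count_space_nat)
qed

lemma nn_integral_count_space_swap:
  fixes f :: "'i::countable \<Rightarrow> 'b \<Rightarrow> ennreal"
  assumes [measurable]: "\<And>i. f i \<in> borel_measurable N"
  shows "(\<integral>\<^sup>+x. \<integral>\<^sup>+i. f i x \<partial>count_space UNIV \<partial>N) = (\<integral>\<^sup>+i. \<integral>\<^sup>+x. f i x \<partial>N \<partial>count_space UNIV)"
  by (simp add: nn_integral_count_space_countable nn_integral_suminf nn_integral_multc)

text \<open>Subadditivity of \<open>x \<mapsto> x\<^sup>s\<close> for infinite sums: if no term exceeds \<open>b\<close>, then \<open>b\<^sup>s\<^sup>-\<^sup>1 a\<^sub>i \<le> a\<^sub>i\<^sup>s\<close> for every term,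
  and it remains to sum up.\<close>

lemma powr_le_nn_integral_powr:
  fixes a :: "'i \<Rightarrow> real"
  assumes b: "0 < b" and s: "0 < s" "s \<le> 1" and a: "\<And>i. 0 \<le> a i"
    and le: "ennreal b \<le> (\<integral>\<^sup>+i. ennreal (a i) \<partial>count_space UNIV)"
  shows "ennreal (b powr s) \<le> (\<integral>\<^sup>+i. ennreal (a i powr s) \<partial>count_space UNIV)"
proof (cases "\<exists>i. b \<le> a i")
  case True
  then obtain i where "b \<le> a i" by blast
  then have "ennreal (b powr s) \<le> ennreal (a i powr s)"
    using b s by (intro ennreal_leI powr_mono2) auto
  also have "\<dots> \<le> (\<integral>\<^sup>+i. ennreal (a i powr s) \<partial>count_space UNIV)"
    by (rule nn_integral_ge_point) simp
  finally show ?thesis .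
next
  case False
  have pointwise: "b powr (s - 1) * a i \<le> a i powr s" for i
  proof (cases "a i = 0")
    case nz: False
    then have i: "0 < a i" using a[of i] by simp
    have "b powr (s - 1) * a i \<le> a i powr (s - 1) * a i"
      using False i s by (intro mult_right_mono powr_mono2') (auto simp: not_le less_imp_le)
    also have "\<dots> = a i powr s" using i powr_add[of "a i" "s - 1" 1] by simp
    finally show ?thesis .
  qed simp
  have "ennreal (b powr s) = ennreal (b powr (s - 1)) * ennreal b"
    using b powr_add[of b "s - 1" 1] by (simp add: ennreal_mult[symmetric])
  also have "\<dots> \<le> ennreal (b powr (s - 1)) * (\<integral>\<^sup>+i. ennreal (a i) \<partial>count_space UNIV)"
    using le by (rule mult_left_mono) simp
  also have "\<dots> = (\<integral>\<^sup>+i. ennreal (b powr (s - 1) * a i) \<partial>count_space UNIV)"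
    using a by (simp add: nn_integral_cmult[symmetric] ennreal_mult)
  also have "\<dots> \<le> (\<integral>\<^sup>+i. ennreal (a i powr s) \<partial>count_space UNIV)"
    using pointwise by (intro nn_integral_mono ennreal_leI)
  finally show ?thesis .
qed

lemma dyadic_level:
  fixes y t :: real
  assumes "0 < t" "t / 2 < y"
  obtains j where "2 ^ j * t / 2 < y" "y \<le> 2 ^ j * t"
proof -
  define n where "n = (LEAST n. y \<le> 2 ^ n * t / 2)"
  obtain k where "2 * y / t < 2 ^ k" using real_arch_pow[of 2 "2 * y / t"] by auto
  then have "y \<le> 2 ^ k * t / 2" using assms by (simp add: field_simps)
  then have n: "y \<le> 2 ^ n * t / 2" unfolding n_def by (rule LeastI)
  then obtain j where j: "n = Suc j" using assms by (cases n) auto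
  have "\<not> y \<le> 2 ^ j * t / 2" using not_less_Least[of j "\<lambda>n. y \<le> 2 ^ n * t / 2"] j
    unfolding n_def by auto
  then show thesis using that[of j] n j by auto
qed

context content_system
begin

text \<open>Pointwise on \<open>K\<close>, \<open>\<bar>g\<bar>\<close> is at most \<open>t / 2\<close> plus \<open>2^j t\<close> times the indicators of the cubes with words in \<open>A j\<close>,
  summed over \<open>j\<close>. Integrate over \<open>Q v\<close>: a covering word is an extension of \<open>v\<close> or incomparable with it, and in
  the latter case it contributes nothing because its cube meets \<open>Q v\<close> in a null set. The term \<open>t / 2 \<cdot> \<mu>(Q v)\<close> is
  absorbed by the left-hand side.\<close>

lemma mass_of_stopping_cube:
  fixes g :: "'a \<Rightarrow> real" and A :: "nat \<Rightarrow> nat list set"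
  assumes t: "0 < t" and A: "\<And>j. A j \<subseteq> W"
    and cover: "\<And>j. {x \<in> K. 2 ^ j * t / 2 < \<bar>g x\<bar>} \<subseteq> (\<Union>w\<in>A j. Q w)"
    and v: "v \<in> W" and no_prefix: "\<And>j w. w \<in> A j \<Longrightarrow> \<not> prefix w v"
    and large: "ennreal t * emeasure \<mu> (Q v) \<le> (\<integral>\<^sup>+y\<in>Q v. ennreal \<bar>g y\<bar> \<partial>\<mu>)"
  shows "ennreal (measure \<mu> (Q v)) \<le> (\<integral>\<^sup>+(j, w). ennreal
    (if w \<in> A j \<and> prefix v w then 2 ^ (j + 1) * measure \<mu> (Q w) else 0) \<partial>count_space UNIV)"
    (is "_ \<le> (\<integral>\<^sup>+i. ?R i \<partial>_)")
proof -
  define T where "T = (SIGMA j:UNIV. A j)"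
  define c where "c = (\<lambda>(j, w). ennreal (2 ^ j * t) * indicator T (j, w))"
  have [measurable]: "Q v \<in> sets borel" using v by (rule cube_borel)
  have T_borel: "Q (snd i) \<in> sets borel" if "i \<in> T" for i
  proof -
    obtain j w where "i = (j, w)" "w \<in> A j" using \<open>i \<in> T\<close> by (auto simp: T_def)
    then show ?thesis using cube_borel subsetD[OF A[of j]] by simp
  qed
  have meas [measurable]: "(\<lambda>x. c i * indicator (Q (snd i) \<inter> Q v) x) \<in> borel_measurable \<mu>" for i
  proof (cases "i \<in> T")
    case True
    then have [measurable]: "Q (snd i) \<in> sets borel" by (rule T_borel)
    show ?thesis by measurable
  qed (simp add: c_def split_beta)
  have pointwise: "ennreal \<bar>g x\<bar> \<le> ennreal (t / 2) + (\<integral>\<^sup>+i. c i * indicator (Q (snd i)) x \<partial>count_space UNIV)"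
    if x: "x \<in> K" for x
  proof (cases "\<bar>g x\<bar> \<le> t / 2")
    case True
    then show ?thesis by (intro add_increasing2 ennreal_leI) auto
  next
    case False
    then obtain j where j: "2 ^ j * t / 2 < \<bar>g x\<bar>" "\<bar>g x\<bar> \<le> 2 ^ j * t"
      using dyadic_level[OF t, of "\<bar>g x\<bar>"] by auto
    then obtain w where w: "w \<in> A j" "x \<in> Q w" using cover[of j] x by blast
    have "ennreal \<bar>g x\<bar> \<le> c (j, w) * indicator (Q (snd (j, w))) x"
      using w j by (simp add: c_def T_def ennreal_leI)
    also have "\<dots> \<le> (\<integral>\<^sup>+i. c i * indicator (Q (snd i)) x \<partial>count_space UNIV)"
      by (rule nn_integral_ge_point) simp
    finally show ?thesis by (rule add_increasing[OF zero_le])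
  qed
  have summand: "c i * emeasure \<mu> (Q (snd i) \<inter> Q v) \<le> ennreal (t / 2) * ?R i" for i
  proof (cases i)
    case (Pair j w)
    show ?thesis
    proof (cases "w \<in> A j")
      case True
      then have w: "w \<in> W" using A by blast
      show ?thesis
      proof (cases "prefix v w")
        case pre: True
        have "emeasure \<mu> (Q w \<inter> Q v) \<le> emeasure \<mu> (Q w)"
          using w by (intro emeasure_mono) auto
        then have "c i * emeasure \<mu> (Q (snd i) \<inter> Q v) \<le> ennreal (2 ^ j * t) * emeasure \<mu> (Q w)"
          using True by (auto simp: Pair c_def T_def intro!: mult_left_mono)
        also have "\<dots> = ennreal (t / 2) * ?R i"
          using True pre t by (simp add: Pair emeasure_eq_measure ennreal_mult[symmetric])
        finally show ?thesis .
      next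
        case False
        then have "parallel w v" using no_prefix[OF True] by (simp add: parallel_def)
        then have "emeasure \<mu> (Q w \<inter> Q v) = 0" using parallel_cubes_null[OF _ w v] by auto
        then show ?thesis by (simp add: Pair)
      qed
    qed (simp add: Pair c_def T_def)
  qed
  have "ennreal t * emeasure \<mu> (Q v) \<le> (\<integral>\<^sup>+y\<in>Q v. ennreal \<bar>g y\<bar> \<partial>\<mu>)" by (rule large)
  also have "\<dots> \<le> (\<integral>\<^sup>+x. ennreal (t / 2) * indicator (Q v) x +
      (\<integral>\<^sup>+i. c i * indicator (Q (snd i) \<inter> Q v) x \<partial>count_space UNIV) \<partial>\<mu>)"
  proof (rule nn_integral_mono)
    fix x
    show "ennreal \<bar>g x\<bar> * indicator (Q v) x \<le> ennreal (t / 2) * indicator (Q v) x +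
        (\<integral>\<^sup>+i. c i * indicator (Q (snd i) \<inter> Q v) x \<partial>count_space UNIV)"
    proof (cases "x \<in> Q v")
      case True
      then show ?thesis using pointwise[of x] cube_subset_K[OF v] by (auto simp: indicator_inter_arith)
    qed simp
  qed
  also have "\<dots> = ennreal (t / 2) * emeasure \<mu> (Q v) +
      (\<integral>\<^sup>+x. \<integral>\<^sup>+i. c i * indicator (Q (snd i) \<inter> Q v) x \<partial>count_space UNIV \<partial>\<mu>)"
    by (subst nn_integral_add) (auto simp: nn_integral_cmult_indicator nn_integral_count_space_countable)
  also have "(\<integral>\<^sup>+x. \<integral>\<^sup>+i. c i * indicator (Q (snd i) \<inter> Q v) x \<partial>count_space UNIV \<partial>\<mu>) =
      (\<integral>\<^sup>+i. \<integral>\<^sup>+x. c i * indicator (Q (snd i) \<inter> Q v) x \<partial>\<mu> \<partial>count_space UNIV)"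
    by (rule nn_integral_count_space_swap) (rule meas)
  also have "\<dots> \<le> (\<integral>\<^sup>+i. ennreal (t / 2) * ?R i \<partial>count_space UNIV)"
  proof (rule nn_integral_mono)
    fix i :: "nat \<times> nat list"
    have "(\<integral>\<^sup>+x. c i * indicator (Q (snd i) \<inter> Q v) x \<partial>\<mu>) = c i * emeasure \<mu> (Q (snd i) \<inter> Q v)"
    proof (cases "i \<in> T")
      case True
      then have "Q (snd i) \<in> sets borel" by (rule T_borel)
      then show ?thesis by (intro nn_integral_cmult_indicator) auto
    qed (simp add: c_def split_beta)
    with summand[of i] show "(\<integral>\<^sup>+x. c i * indicator (Q (snd i) \<inter> Q v) x \<partial>\<mu>) \<le> ennreal (t / 2) * ?R i"
      by simp
  qed
  also have "\<dots> = ennreal (t / 2) * (\<integral>\<^sup>+i. ?R i \<partial>count_space UNIV)"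
    by (simp add: nn_integral_cmult)
  finally have "ennreal (t / 2) * emeasure \<mu> (Q v) + ennreal (t / 2) * emeasure \<mu> (Q v)
      \<le> ennreal (t / 2) * emeasure \<mu> (Q v) + ennreal (t / 2) * (\<integral>\<^sup>+i. ?R i \<partial>count_space UNIV)"
    using t by (simp add: distrib_right[symmetric] ennreal_plus[symmetric] del: ennreal_plus)
  then have "ennreal (t / 2) * emeasure \<mu> (Q v) \<le> ennreal (t / 2) * (\<integral>\<^sup>+i. ?R i \<partial>count_space UNIV)"
    by (simp add: emeasure_eq_measure ennreal_mult_eq_top_iff)
  then show ?thesis
    using t by (simp add: emeasure_eq_measure ennreal_mult_le_mult_iff)
qed

text \<open>The level set is covered by the words in the sets \<open>A j\<close> together with the stopping words \<open>V\<close>: the shortest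
  words with large mean that extend no covering word. The cost of \<open>V\<close> is estimated by exchanging the order of
  summation; a covering word extends at most one element of the antichain \<open>V\<close>.\<close>

lemma content_maximal_level_set_le_cost:
  fixes g :: "'a \<Rightarrow> real" and A :: "nat \<Rightarrow> nat list set"
  assumes t: "0 < t" and A: "\<And>j. A j \<subseteq> W"
    and cover: "\<And>j. {x \<in> K. 2 ^ j * t / 2 < \<bar>g x\<bar>} \<subseteq> (\<Union>w\<in>A j. Q w)"
  shows "H {x \<in> K. ennreal t < M g x} \<le> (\<Sum>j. ennreal (3 * (2 ^ j) powr \<beta>) * cost (A j))"
proof -
  define P where "P v \<longleftrightarrow> v \<in> W \<and> v \<noteq> [] \<and>
    ennreal t * emeasure \<mu> (Q v) \<le> (\<integral>\<^sup>+y\<in>Q v. ennreal \<bar>g y\<bar> \<partial>\<mu>)" for v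
  define V where "V = {v. P v \<and> (\<forall>u. strict_prefix u v \<longrightarrow> \<not> P u) \<and> (\<forall>j. \<forall>w\<in>A j. \<not> prefix w v)}"
  define h where "h v = (\<lambda>(j, w). ennreal
    ((if w \<in> A j \<and> prefix v w then 2 ^ (j + 1) * measure \<mu> (Q w) else 0) powr \<beta>) * indicator V v)" for v
  have "{x \<in> K. ennreal t < M g x} \<subseteq> (\<Union>w\<in>V \<union> (\<Union>j. A j). Q w)"
  proof
    fix x assume "x \<in> {x \<in> K. ennreal t < M g x}"
    then obtain v where v: "v \<in> W" "v \<noteq> []" "x \<in> Q v"
      and less: "ennreal t < (\<integral>\<^sup>+y\<in>Q v. ennreal \<bar>g y\<bar> \<partial>\<mu>) / emeasure \<mu> (Q v)"
      unfolding maximal_function_eq by (auto simp: less_SUP_iff)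
    have "ennreal t * emeasure \<mu> (Q v) \<le> (\<integral>\<^sup>+y\<in>Q v. ennreal \<bar>g y\<bar> \<partial>\<mu>)"
      using mult_right_mono[OF less_imp_le[OF less], of "emeasure \<mu> (Q v)"] average_times_measure[OF v(1)]
      by simp
    then have "P v" using v by (simp add: P_def)
    then obtain u where u: "prefix u v" "P u" "\<And>w. strict_prefix w u \<Longrightarrow> \<not> P w"
      using minimal_prefix[of P v] by blast
    have xu: "x \<in> Q u" using cube_antimono[OF u(1) v(1)] v(3) by auto
    show "x \<in> (\<Union>w\<in>V \<union> (\<Union>j. A j). Q w)"
    proof (cases "\<exists>j. \<exists>w\<in>A j. prefix w u")
      case True
      then obtain j w where "w \<in> A j" "prefix w u" by blast
      moreover from this have "x \<in> Q w" using cube_antimono[of w u] u(2) xu by (auto simp: P_def)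
      ultimately show ?thesis by blast
    next
      case False
      then have "u \<in> V" using u by (auto simp: V_def)
      then show ?thesis using xu by blast
    qed
  qed
  moreover have "V \<union> (\<Union>j. A j) \<subseteq> W" using A by (auto simp: V_def P_def)
  ultimately have "H {x \<in> K. ennreal t < M g x} \<le> cost (V \<union> (\<Union>j. A j))"
    by (intro content_le_cost)
  also have "\<dots> \<le> cost V + (\<Sum>j. cost (A j))"
    using cost_Un cost_UN by (meson add_left_mono order_trans)
  also have "cost V \<le> (\<Sum>j. ennreal ((2 ^ (j + 1)) powr \<beta>) * cost (A j))"
  proof -
    have "cost V \<le> (\<integral>\<^sup>+v. \<integral>\<^sup>+i. h v i \<partial>count_space UNIV \<partial>count_space UNIV)"
      unfolding cost_def
    proof (rule nn_integral_mono)
      fix v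
      show "ennreal (measure \<mu> (Q v) powr \<beta>) * indicator V v \<le> (\<integral>\<^sup>+i. h v i \<partial>count_space UNIV)"
      proof (cases "v \<in> V")
        case True
        then have v: "v \<in> W" "P v" "\<And>j w. w \<in> A j \<Longrightarrow> \<not> prefix w v" by (auto simp: V_def P_def)
        have "ennreal (measure \<mu> (Q v) powr \<beta>) \<le> (\<integral>\<^sup>+i. ennreal ((case i of (j, w) \<Rightarrow>
            if w \<in> A j \<and> prefix v w then 2 ^ (j + 1) * measure \<mu> (Q w) else 0) powr \<beta>) \<partial>count_space UNIV)"
        proof (rule powr_le_nn_integral_powr)
          have "ennreal (measure \<mu> (Q v)) \<le> (\<integral>\<^sup>+(j, w). ennreal
              (if w \<in> A j \<and> prefix v w then 2 ^ (j + 1) * measure \<mu> (Q w) else 0) \<partial>count_space UNIV)"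
            by (rule mass_of_stopping_cube[OF t A cover]) (use v in \<open>auto simp: P_def\<close>)
          then show "ennreal (measure \<mu> (Q v)) \<le> (\<integral>\<^sup>+i. ennreal (case i of (j, w) \<Rightarrow>
              if w \<in> A j \<and> prefix v w then 2 ^ (j + 1) * measure \<mu> (Q w) else 0) \<partial>count_space UNIV)"
            by (simp add: case_prod_unfold)
        qed (use cube_pos[OF v(1)] beta in \<open>auto simp: split_beta\<close>)
        then show ?thesis using True by (simp add: h_def split_beta)
      qed simp
    qed
    also have "\<dots> = (\<integral>\<^sup>+i. \<integral>\<^sup>+v. h v i \<partial>count_space UNIV \<partial>count_space UNIV)"
      by (rule nn_integral_count_space_swap) simp
    also have "\<dots> \<le> (\<integral>\<^sup>+(j, w). ennreal ((2 ^ (j + 1)) powr \<beta>) *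
        (ennreal (measure \<mu> (Q w) powr \<beta>) * indicator (A j) w) \<partial>count_space UNIV)"
    proof (rule nn_integral_mono)
      fix i :: "nat \<times> nat list"
      obtain j w where i: "i = (j, w)" by (cases i)
      let ?c = "ennreal ((2 ^ (j + 1)) powr \<beta>) * (ennreal (measure \<mu> (Q w) powr \<beta>) * indicator (A j) w)"
      have "(\<integral>\<^sup>+v. h v i \<partial>count_space UNIV) \<le> ?c"
      proof (cases "\<exists>u\<in>V. prefix u w")
        case True
        then obtain u where u: "u \<in> V" "prefix u w" by blast
        have unique: "v = u" if "v \<in> V" "prefix v w" for v
          using antichain_extensions_unique[OF that(2) u(2)] that(1) u(1) by (auto simp: V_def)
        have "(\<integral>\<^sup>+v. h v i \<partial>count_space UNIV) \<le> (\<integral>\<^sup>+v. ?c * indicator {u} v \<partial>count_space UNIV)"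
        proof (rule nn_integral_mono)
          fix v
          show "h v i \<le> ?c * indicator {u} v"
          proof (cases "v \<in> V \<and> prefix v w \<and> w \<in> A j")
            case True
            then have "v = u" using unique by simp
            then show ?thesis using True by (simp add: h_def i powr_mult ennreal_mult)
          next
            case False
            then have "h v i = 0" by (auto simp: h_def i)
            then show ?thesis by simp
          qed
        qed
        also have "\<dots> = ?c" by (subst nn_integral_cmult_indicator) simp_all
        finally show ?thesis .
      next
        case False
        then have "h v i = 0" for v by (auto simp: h_def i)
        then show ?thesis by simp
      qed
      then show "(\<integral>\<^sup>+v. h v i \<partial>count_space UNIV) \<le> (case i of (j, w) \<Rightarrow>
          ennreal ((2 ^ (j + 1)) powr \<beta>) * (ennreal (measure \<mu> (Q w) powr \<beta>) * indicator (A j) w))"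
        by (simp add: i)
    qed
    also have "\<dots> = (\<Sum>j. ennreal ((2 ^ (j + 1)) powr \<beta>) * cost (A j))"
      by (subst nn_integral_fst_count_space[symmetric])
        (simp add: nn_integral_count_space_nat nn_integral_cmult cost_def)
    finally show ?thesis .
  qed
  also have "(\<Sum>j. ennreal ((2 ^ (j + 1)) powr \<beta>) * cost (A j)) + (\<Sum>j. cost (A j)) =
      (\<Sum>j. ennreal ((2 ^ (j + 1)) powr \<beta>) * cost (A j) + cost (A j))"
    by (intro suminf_add summableI)
  also have "\<dots> \<le> (\<Sum>j. ennreal (3 * (2 ^ j) powr \<beta>) * cost (A j))"
  proof (intro suminf_le summableI)
    fix j :: nat
    have "(2::real) powr \<beta> \<le> 2 powr 1" using beta by (intro powr_mono) auto
    then have "(2 ^ (j + 1)) powr \<beta> \<le> 2 * (2 ^ j :: real) powr \<beta>"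
      by (simp add: powr_mult mult_right_mono)
    moreover have "1 \<le> (2 ^ j :: real) powr \<beta>" using beta by (intro ge_one_powr_ge_zero) auto
    ultimately have "(2 ^ (j + 1)) powr \<beta> + 1 \<le> 3 * (2 ^ j :: real) powr \<beta>" by simp
    then have "ennreal ((2 ^ (j + 1)) powr \<beta>) + 1 \<le> ennreal (3 * (2 ^ j) powr \<beta>)"
      by (simp flip: ennreal_1 ennreal_plus del: ennreal_1)
    from mult_right_mono[OF this, of "cost (A j)"]
    show "ennreal ((2 ^ (j + 1)) powr \<beta>) * cost (A j) + cost (A j) \<le> ennreal (3 * (2 ^ j) powr \<beta>) * cost (A j)"
      by (simp add: distrib_right)
  qed
  finally show ?thesis by (simp add: add_right_mono)
qed

text \<open>Near-optimal covers of all level sets of \<open>g\<close> at once: the errors \<open>d j\<close> are chosen so that, weighted with the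
  coefficients of the series, they add up to \<open>e\<close>.\<close>

lemma content_maximal_level_set:
  fixes g :: "'a \<Rightarrow> real"
  assumes t: "0 < t"
  shows "H {x \<in> K. ennreal t < M g x} \<le>
    (\<Sum>j. ennreal (3 * (2 ^ j) powr \<beta>) * H {x \<in> K. ennreal (2 ^ j / 2 * t) < ennreal \<bar>g x\<bar>})"
proof (rule ennreal_le_epsilon)
  fix e :: real assume e: "0 < e"
  define E where "E j = {x \<in> K. 2 ^ j * t / 2 < \<bar>g x\<bar>}" for j
  define c where "c j = 3 * (2 ^ j :: real) powr \<beta>" for j
  have c: "0 < c j" for j by (simp add: c_def)
  define d where "d j = e * (1 / 2) ^ Suc j / c j" for j
  have d: "0 < d j" for j using e c by (simp add: d_def)
  have "H (E j) < H (E j) + ennreal (d j)" for j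
  proof -
    have "H (E j) \<noteq> top"
      using content_le_1[of "E j"] by (auto simp: E_def top_unique)
    then show ?thesis using d[of j] by (cases "H (E j)") (auto simp: ennreal_less_iff simp flip: ennreal_plus)
  qed
  then have "\<forall>j. \<exists>A. A \<subseteq> W \<and> E j \<subseteq> (\<Union>w\<in>A. Q w) \<and> cost A < H (E j) + ennreal (d j)"
    by (meson content_cover)
  then obtain A where A: "\<And>j. A j \<subseteq> W" "\<And>j. E j \<subseteq> (\<Union>w\<in>A j. Q w)"
    "\<And>j. cost (A j) < H (E j) + ennreal (d j)"
    by metis
  have "H {x \<in> K. ennreal t < M g x} \<le> (\<Sum>j. ennreal (c j) * cost (A j))"
    unfolding c_def using A t by (intro content_maximal_level_set_le_cost) (auto simp: E_def)
  also have "\<dots> \<le> (\<Sum>j. ennreal (c j) * H (E j) + ennreal (e * (1 / 2) ^ Suc j))"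
  proof (intro suminf_le summableI)
    fix j
    have "ennreal (c j) * cost (A j) \<le> ennreal (c j) * (H (E j) + ennreal (d j))"
      using A(3)[of j] by (intro mult_left_mono) auto
    also have "ennreal (c j) * ennreal (d j) = ennreal (e * (1 / 2) ^ Suc j)"
      using c[of j] d[of j] by (simp add: ennreal_mult[symmetric] d_def)
    then have "ennreal (c j) * (H (E j) + ennreal (d j)) = ennreal (c j) * H (E j) + ennreal (e * (1 / 2) ^ Suc j)"
      by (simp add: distrib_left)
    finally show "ennreal (c j) * cost (A j) \<le> ennreal (c j) * H (E j) + ennreal (e * (1 / 2) ^ Suc j)" .
  qed
  also have "\<dots> = (\<Sum>j. ennreal (c j) * H (E j)) + (\<Sum>j. ennreal (e * (1 / 2) ^ Suc j))"
    by (intro suminf_add[symmetric] summableI)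
  also have "(\<Sum>j. ennreal (e * (1 / 2) ^ Suc j)) = ennreal e"
    using sums_mult[OF power_half_series, of e] e by (intro suminf_ennreal_eq) auto
  finally have "H {x \<in> K. ennreal t < M g x} \<le> (\<Sum>j. ennreal (c j) * H (E j)) + ennreal e" .
  moreover have "E = (\<lambda>j. {x \<in> K. ennreal (2 ^ j / 2 * t) < ennreal \<bar>g x\<bar>})"
    using t by (simp add: E_def ennreal_less_iff fun_eq_iff)
  ultimately show "H {x \<in> K. ennreal t < M g x} \<le>
    (\<Sum>j. ennreal (3 * (2 ^ j) powr \<beta>) * H {x \<in> K. ennreal (2 ^ j / 2 * t) < ennreal \<bar>g x\<bar>}) + ennreal e"
    by (simp add: c_def)
qed

end


section \<open>Choquet integrals and norms\<close>

text \<open>Distribution functions with respect to the content are decreasing and bounded by \<open>1\<close>.\<close>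

lemma borel_measurable_antimono_le_1:
  fixes \<phi> :: "real \<Rightarrow> ennreal"
  assumes "antimono \<phi>" and le: "\<And>t. \<phi> t \<le> 1"
  shows "\<phi> \<in> borel_measurable borel"
proof -
  have fin: "\<phi> t < top" for t using le[of t] by (rule le_less_trans) simp
  have "mono (\<lambda>t. - enn2real (\<phi> t))"
    using assms(1) fin by (auto simp: mono_def antimono_def intro!: enn2real_mono)
  then have "(\<lambda>t. - enn2real (\<phi> t)) \<in> borel_measurable borel" by (rule borel_measurable_mono)
  then have "(\<lambda>t. ennreal (- (- enn2real (\<phi> t)))) \<in> borel_measurable borel" by measurable
  then show ?thesis using fin by simp
qed

lemma nn_integral_powr_scale:
  fixes \<phi> :: "real \<Rightarrow> ennreal"
  assumes [measurable]: "\<phi> \<in> borel_measurable borel" and c: "0 < c"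
  shows "(\<integral>\<^sup>+t\<in>{0<..}. ennreal (t powr (p - 1)) * \<phi> (c * t) \<partial>lborel) =
    ennreal (c powr (- p)) * (\<integral>\<^sup>+t\<in>{0<..}. ennreal (t powr (p - 1)) * \<phi> t \<partial>lborel)"
    (is "?L = _ * ?R")
proof -
  have "?R = ennreal \<bar>c\<bar> * (\<integral>\<^sup>+t. ennreal ((0 + c * t) powr (p - 1)) * \<phi> (0 + c * t) * indicator {0<..} (0 + c * t) \<partial>lborel)"
    using c by (intro nn_integral_real_affine) auto
  also have "(\<integral>\<^sup>+t. ennreal ((0 + c * t) powr (p - 1)) * \<phi> (0 + c * t) * indicator {0<..} (0 + c * t) \<partial>lborel)
      = (\<integral>\<^sup>+t. ennreal (c powr (p - 1)) * (ennreal (t powr (p - 1)) * \<phi> (c * t) * indicator {0<..} t) \<partial>lborel)"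
    using c by (intro nn_integral_cong)
      (auto simp: powr_mult ennreal_mult zero_less_mult_iff mult.assoc split: split_indicator)
  also have "\<dots> = ennreal (c powr (p - 1)) * ?L"
    by (rule nn_integral_cmult) measurable
  finally have "?R = ennreal (c * c powr (p - 1)) * ?L"
    using c by (simp add: ennreal_mult mult.assoc)
  also have "c * c powr (p - 1) = c powr p" using c powr_add[of c 1 "p - 1"] by simp
  finally have "ennreal (c powr (- p)) * ?R = ennreal (c powr (- p) * c powr p) * ?L"
    by (simp add: ennreal_mult mult.assoc)
  also have "c powr (- p) * c powr p = 1" using c by (simp add: powr_minus)
  finally show ?thesis by simp
qed

context content_system
begin

lemma content_norm_mono:
  assumes "\<And>x. x \<in> K \<Longrightarrow> u x \<le> v x"
  shows "content_norm K H p u \<le> content_norm K H p v"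
proof (cases "p = \<infinity>")
  case True
  have "ess_sup_content K H u \<le> ess_sup_content K H v"
    unfolding ess_sup_content_def using assms by (intro INF_mono) (auto intro!: SUP_mono)
  then show ?thesis using True by (simp add: content_norm_def)
next
  case False
  define J where "J w = choquet_power_integral K H (enn2real p) w" for w
  have "J u \<le> J v"
    unfolding J_def choquet_power_integral_def
  proof (intro mult_left_mono nn_integral_mono mult_right_mono)
    fix t
    show "H {x \<in> K. ennreal t < u x} \<le> H {x \<in> K. ennreal t < v x}"
      using assms by (intro content_mono) (auto intro: less_le_trans)
  qed auto
  moreover from this have "enn2real (J u) powr (1 / enn2real p) \<le> enn2real (J v) powr (1 / enn2real p)"
    if "J v \<noteq> \<infinity>"
    using that by (intro powr_mono2 enn2real_mono) (auto simp: less_top)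
  ultimately show ?thesis
    using False by (auto simp: content_norm_def J_def[symmetric] Let_def top_unique intro!: ennreal_leI)
qed

text \<open>Integrate the level set estimate term by term. The substitution \<open>t \<mapsto> 2^(j-1) t\<close> costs the factor
  \<open>2^(-(j-1) p)\<close>, which against the coefficient \<open>3 \<cdot> 2^(j \<beta>)\<close> leaves a geometric series of ratio \<open>2^(\<beta> - p) < 1\<close>.\<close>

lemma choquet_maximal_le:
  fixes g :: "'a \<Rightarrow> real"
  assumes p: "\<beta> < p"
  shows "choquet_power_integral K H p (M g) \<le>
    ennreal (3 * 2 powr p / (1 - 2 powr (\<beta> - p))) * choquet_power_integral K H p (\<lambda>x. ennreal \<bar>g x\<bar>)"
proof -
  define \<phi> where "\<phi> t = H {x \<in> K. ennreal t < ennreal \<bar>g x\<bar>}" for t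
  define I where "I = (\<integral>\<^sup>+t\<in>{0<..}. ennreal (t powr (p - 1)) * \<phi> t \<partial>lborel)"
  define c where "c j = 3 * (2 ^ j :: real) powr \<beta>" for j
  have \<phi> [measurable]: "\<phi> \<in> borel_measurable borel"
  proof (rule borel_measurable_antimono_le_1)
    show "antimono \<phi>"
    proof (rule antimonoI)
      fix s t :: real assume "s \<le> t"
      then show "\<phi> t \<le> \<phi> s"
        unfolding \<phi>_def by (intro content_mono) (auto intro: le_less_trans[OF ennreal_leI])
    qed
  qed (auto simp: \<phi>_def intro!: content_le_1)
  have "(\<integral>\<^sup>+t\<in>{0<..}. ennreal (t powr (p - 1)) * H {x \<in> K. ennreal t < M g x} \<partial>lborel) \<le>
      (\<integral>\<^sup>+t\<in>{0<..}. ennreal (t powr (p - 1)) * (\<Sum>j. ennreal (c j) * \<phi> (2 ^ j / 2 * t)) \<partial>lborel)"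
  proof (rule nn_integral_mono)
    fix t
    show "ennreal (t powr (p - 1)) * H {x \<in> K. ennreal t < M g x} * indicator {0<..} t \<le>
        ennreal (t powr (p - 1)) * (\<Sum>j. ennreal (c j) * \<phi> (2 ^ j / 2 * t)) * indicator {0<..} t"
    proof (cases "0 < t")
      case True
      show ?thesis
        unfolding \<phi>_def c_def
        by (intro mult_right_mono mult_left_mono content_maximal_level_set True) simp_all
    qed simp
  qed
  also have "\<dots> = (\<integral>\<^sup>+t. (\<Sum>j. ennreal (c j) * (ennreal (t powr (p - 1)) * \<phi> (2 ^ j / 2 * t) * indicator {0<..} t)) \<partial>lborel)"
    by (simp add: ennreal_suminf_cmult[symmetric] ennreal_suminf_multc[symmetric] ac_simps)
  also have "\<dots> = (\<Sum>j. ennreal (c j) * (\<integral>\<^sup>+t\<in>{0<..}. ennreal (t powr (p - 1)) * \<phi> (2 ^ j / 2 * t) \<partial>lborel))"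
    by (simp add: nn_integral_suminf nn_integral_cmult)
  also have "\<dots> = (\<Sum>j. ennreal (3 * 2 powr p * (2 powr (\<beta> - p)) ^ j) * I)"
  proof (rule suminf_cong)
    fix j
    have coeff: "c j * (2 ^ j / 2) powr (- p) = 3 * 2 powr p * (2 powr (\<beta> - p)) ^ j"
    proof -
      have scale: "(2 ^ j / 2 :: real) powr (- p) = (2 ^ j) powr (- p) * 2 powr p"
      proof -
        have "(2 ^ j / 2 :: real) powr (- p) = (2 ^ j) powr (- p) / 2 powr (- p)"
          by (rule powr_divide)
        then show ?thesis by (simp only: powr_minus divide_inverse inverse_inverse_eq)
      qed
      have ratio: "(2 ^ j :: real) powr \<beta> * (2 ^ j) powr (- p) = (2 powr (\<beta> - p)) ^ j"
      proof -
        have "(2 ^ j :: real) powr \<beta> * (2 ^ j) powr (- p) = (2 ^ j) powr (\<beta> - p)"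
          using powr_add[of "2 ^ j :: real" \<beta> "- p"] by simp
        also have "\<dots> = (2 powr real j) powr (\<beta> - p)" by (subst powr_realpow) simp_all
        also have "\<dots> = (2 powr (\<beta> - p)) powr real j" by (simp only: powr_powr mult.commute)
        also have "\<dots> = (2 powr (\<beta> - p)) ^ j" by (rule powr_realpow) simp
        finally show ?thesis .
      qed
      show ?thesis unfolding c_def scale ratio[symmetric] by (simp only: ac_simps)
    qed
    have "(\<integral>\<^sup>+t\<in>{0<..}. ennreal (t powr (p - 1)) * \<phi> (2 ^ j / 2 * t) \<partial>lborel) =
        ennreal ((2 ^ j / 2) powr (- p)) * I"
      unfolding I_def by (rule nn_integral_powr_scale) simp_all
    moreover have "ennreal (c j) * (ennreal ((2 ^ j / 2) powr (- p)) * I) =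
        ennreal (c j * (2 ^ j / 2) powr (- p)) * I"
      by (subst ennreal_mult) (simp_all add: c_def mult.assoc)
    ultimately show "ennreal (c j) * (\<integral>\<^sup>+t\<in>{0<..}. ennreal (t powr (p - 1)) * \<phi> (2 ^ j / 2 * t) \<partial>lborel) =
        ennreal (3 * 2 powr p * (2 powr (\<beta> - p)) ^ j) * I"
      by (simp only: coeff)
  qed
  also have "\<dots> = (\<Sum>j. ennreal (3 * 2 powr p * (2 powr (\<beta> - p)) ^ j)) * I"
    by (rule ennreal_suminf_multc)
  also have "(\<Sum>j. ennreal (3 * 2 powr p * (2 powr (\<beta> - p)) ^ j)) = ennreal (3 * 2 powr p / (1 - 2 powr (\<beta> - p)))"
  proof -
    have "2 powr (\<beta> - p) < 2 powr (0::real)" using p by (intro powr_less_mono) auto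
    then have "(\<lambda>j. 3 * 2 powr p * (2 powr (\<beta> - p)) ^ j) sums (3 * 2 powr p * (1 / (1 - 2 powr (\<beta> - p))))"
      by (intro sums_mult geometric_sums) simp
    then show ?thesis by (intro suminf_ennreal_eq) auto
  qed
  finally show ?thesis
    unfolding choquet_power_integral_def
    using mult_left_mono[of _ _ "ennreal p"] by (simp add: I_def \<phi>_def mult.left_commute)
qed

text \<open>A bound for \<open>\<bar>g\<bar>\<close> off a set of content zero holds almost everywhere, hence bounds all means over cubes: it bounds
  \<open>M g\<close> at every point.\<close>

lemma ess_sup_maximal_le:
  "ess_sup_content K H (M g) \<le> ess_sup_content K H (\<lambda>x. ennreal \<bar>g x\<bar>)"
  unfolding ess_sup_content_def[of _ _ "\<lambda>x. ennreal \<bar>g x\<bar>"]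
proof (rule INF_greatest)
  fix E assume "E \<in> {E. E \<subseteq> K \<and> H E = 0}"
  then obtain N where N: "N \<in> null_sets \<mu>" "E \<subseteq> N" using content_zero_imp_null by blast
  define b where "b = (SUP x\<in>K - E. ennreal \<bar>g x\<bar>)"
  have "AE x in \<mu>. ennreal \<bar>g x\<bar> \<le> b"
    using AE_not_in[OF N(1)] AE_in_K
  proof eventually_elim
    case (elim x)
    then show ?case unfolding b_def using N(2) by (intro SUP_upper) auto
  qed
  then have M_le: "M g x \<le> b" for x
    unfolding maximal_function_eq
  proof (intro SUP_least)
    fix v assume ae: "AE x in \<mu>. ennreal \<bar>g x\<bar> \<le> b" and v: "v \<in> {v \<in> W - {[]}. x \<in> Q v}"
    then have vW: "v \<in> W" by simp
    have "(\<integral>\<^sup>+y\<in>Q v. ennreal \<bar>g y\<bar> \<partial>\<mu>) \<le> (\<integral>\<^sup>+y\<in>Q v. b \<partial>\<mu>)"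
    proof (rule nn_integral_mono_AE)
      show "AE y in \<mu>. ennreal \<bar>g y\<bar> * indicator (Q v) y \<le> b * indicator (Q v) y"
        using ae by eventually_elim (simp add: mult_right_mono)
    qed
    also have "\<dots> = emeasure \<mu> (Q v) * b"
      using vW by (simp add: nn_integral_cmult_indicator mult.commute)
    finally show "(\<integral>\<^sup>+y\<in>Q v. ennreal \<bar>g y\<bar> \<partial>\<mu>) / emeasure \<mu> (Q v) \<le> b"
      using cube_pos[OF vW] by (intro divide_le_posI_ennreal) (auto simp: emeasure_eq_measure)
  qed
  have "H {} = 0" using content_le_cost[of "{}" "{}"] by (simp add: cost_def)
  then have "ess_sup_content K H (M g) \<le> (SUP x\<in>K - {}. M g x)"
    unfolding ess_sup_content_def by (intro INF_lower) auto
  also have "\<dots> \<le> b" using M_le by (intro SUP_least)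
  finally show "ess_sup_content K H (M g) \<le> (SUP x\<in>K - E. ennreal \<bar>g x\<bar>)" by (simp add: b_def)
qed

lemma content_norm_maximal_le:
  assumes p: "ennreal \<beta> < p"
  obtains C :: real where "0 < C"
    "\<And>g. content_norm K H p (M g) \<le> ennreal C * content_norm K H p (\<lambda>x. ennreal \<bar>g x\<bar>)"
proof (cases "p = \<infinity>")
  case True
  then have "content_norm K H p (M g) \<le> ennreal 1 * content_norm K H p (\<lambda>x. ennreal \<bar>g x\<bar>)" for g
    using ess_sup_maximal_le[of g] by (simp add: content_norm_def)
  then show thesis using that[of 1] by simp
next
  case False
  define P where "P = enn2real p"
  have "p = ennreal P" using False by (simp add: P_def less_top)
  then have P: "\<beta> < P" using p beta by (simp add: ennreal_less_iff)
  define B where "B = 3 * 2 powr P / (1 - 2 powr (\<beta> - P))"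
  have "2 powr (\<beta> - P) < 2 powr (0::real)" using P by (intro powr_less_mono) auto
  then have B: "0 < B" by (simp add: B_def)
  show thesis
  proof (rule that)
    show "0 < B powr (1 / P)" using B by simp
    fix g
    let ?J = "choquet_power_integral K H P (\<lambda>x. ennreal \<bar>g x\<bar>)"
    have J: "choquet_power_integral K H P (M g) \<le> ennreal B * ?J"
      unfolding B_def by (rule choquet_maximal_le[OF P])
    show "content_norm K H p (M g) \<le> ennreal (B powr (1 / P)) * content_norm K H p (\<lambda>x. ennreal \<bar>g x\<bar>)"
    proof (cases "?J = \<infinity>")
      case True
      then show ?thesis using B False by (simp add: content_norm_def P_def ennreal_mult_top)
    next
      case J_fin: False
      then have fin: "ennreal B * ?J < top" by (simp add: ennreal_mult_less_top less_top)
      then have "choquet_power_integral K H P (M g) \<noteq> \<infinity>" using J by (auto simp: top_unique)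
      moreover have "enn2real (choquet_power_integral K H P (M g)) powr (1 / P) \<le>
          (B * enn2real ?J) powr (1 / P)"
        using enn2real_mono[OF J fin] B P beta by (intro powr_mono2) (auto simp: enn2real_mult)
      ultimately show ?thesis
        using False J_fin B by (simp add: content_norm_def P_def[symmetric] powr_mult ennreal_mult[symmetric])
    qed
  qed
qed

text \<open>The version that vanishes where \<open>\<bar>f\<bar>\<close> exceeds \<open>M f\<close> is dominated by \<open>M f\<close> everywhere.\<close>

lemma version_norm_le_maximal:
  assumes f: "f \<in> borel_measurable (completion \<mu>)"
  shows "version_norm K \<mu> H p f \<le> content_norm K H p (M f)"
proof -
  \<comment> \<open>At points of the exceptional null set \<open>f\<close> itself may exceed \<open>M f\<close>, and such a set may have positive content.\<close>
  define g where "g x = (if ennreal \<bar>f x\<bar> \<le> M f x then f x else 0)" for x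
  have "AE x in \<mu>. g x = f x"
    using AE_le_maximal_function[OF f] by eventually_elim (simp add: g_def)
  moreover have "g \<in> borel_measurable (completion \<mu>)"
  proof -
    have [measurable]: "M f \<in> borel_measurable (completion \<mu>)"
      using maximal_function_borel by (rule measurable_completion)
    note f [measurable]
    show ?thesis unfolding g_def by measurable
  qed
  ultimately have "version_norm K \<mu> H p f \<le> content_norm K H p (\<lambda>x. ennreal \<bar>g x\<bar>)"
    unfolding version_norm_def by (intro INF_lower) simp
  also have "\<dots> \<le> content_norm K H p (M f)"
    by (rule content_norm_mono) (simp add: g_def)
  finally show ?thesis .
qed

text \<open>All versions have the same maximal function, so the infimum over the versions can be taken on the right.\<close>

lemma maximal_le_version_norm:
  assumes C: "0 < C"
    and bound: "\<And>g. content_norm K H p (M g) \<le> ennreal C * content_norm K H p (\<lambda>x. ennreal \<bar>g x\<bar>)"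
  shows "content_norm K H p (M f) \<le> ennreal C * version_norm K \<mu> H p f"
proof -
  have "ennreal (1 / C) * content_norm K H p (M f) \<le> version_norm K \<mu> H p f"
    unfolding version_norm_def
  proof (rule INF_greatest)
    fix g assume "g \<in> {g \<in> borel_measurable (completion \<mu>). AE x in \<mu>. g x = f x}"
    then have "M f = M g" using maximal_function_cong[of g f] by simp
    then have "ennreal (1 / C) * content_norm K H p (M f) \<le>
        ennreal (1 / C) * (ennreal C * content_norm K H p (\<lambda>x. ennreal \<bar>g x\<bar>))"
      using bound[of g] by (simp add: mult_left_mono)
    then show "ennreal (1 / C) * content_norm K H p (M f) \<le> content_norm K H p (\<lambda>x. ennreal \<bar>g x\<bar>)"
      using C by (simp add: mult.assoc[symmetric] ennreal_mult[symmetric])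
  qed
  then have "ennreal C * (ennreal (1 / C) * content_norm K H p (M f)) \<le> ennreal C * version_norm K \<mu> H p f"
    by (rule mult_left_mono) simp
  then show ?thesis using C by (simp add: mult.assoc[symmetric] ennreal_mult[symmetric])
qed

end


section \<open>Boundedness of the maximal operator\<close>

theorem theorem1p5:
  fixes S :: "nat \<Rightarrow> 'a::euclidean_space \<Rightarrow> 'a"
    and m :: nat and K :: "'a set" and q :: "nat \<Rightarrow> real" and \<mu> :: "'a measure"
    and \<alpha> :: real and p :: ennreal
  defines "H \<equiv> cube_content m S K \<mu> \<alpha>"
    and "M \<equiv> maximal_function m S K \<mu>"
  assumes "\<And>i. i \<in> {1..m} \<Longrightarrow> contracting_similarity (S i)"
    and "\<not> (\<exists>x. \<forall>i\<in>{1..m}. S i x = x)"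
    and "self_similar_set m S K"
    and "\<And>i. i \<in> {1..m} \<Longrightarrow> 0 < q i" and "(\<Sum>i=1..m. q i) = 1"
    and "self_similar_measure m S q \<mu>"
    and "post_critically_finite m S K"
    and "0 < \<alpha>" and "\<alpha> \<le> hausdorff_dim K"
    and "ennreal (\<alpha> / hausdorff_dim K) < p" and "p \<le> \<infinity>"
  shows "(\<forall>f\<in>borel_measurable (completion \<mu>).
            f \<in> content_space K \<mu> H p \<longleftrightarrow> M f \<in> content_space_nonneg K \<mu> H p) \<and>
         (\<exists>C::real. C > 0 \<and>
            (\<forall>f\<in>content_space K \<mu> H p.
               version_norm K \<mu> H p f \<le> content_norm K H p (M f) \<and>
               content_norm K H p (M f) \<le> ennreal C * version_norm K \<mu> H p f))"
proof -
  interpret X: content_system S m K q \<mu> \<alpha>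
    using assms(3-11) by unfold_locales
  have "ennreal X.\<beta> < p" using assms(12) by (simp add: X.\<beta>_def)
  then obtain C where C: "0 < C"
    "\<And>g. content_norm K H p (M g) \<le> ennreal C * content_norm K H p (\<lambda>x. ennreal \<bar>g x\<bar>)"
    using X.content_norm_maximal_le unfolding H_def M_def by blast
  have upper: "content_norm K H p (M f) \<le> ennreal C * version_norm K \<mu> H p f" for f
    using C unfolding H_def M_def by (rule X.maximal_le_version_norm)
  have lower: "version_norm K \<mu> H p f \<le> content_norm K H p (M f)"
    if "f \<in> borel_measurable (completion \<mu>)" for f
    using that unfolding H_def M_def by (rule X.version_norm_le_maximal)
  have measurable: "M f \<in> borel_measurable (completion \<mu>)" for f
    unfolding M_def using X.maximal_function_borel by (rule measurable_completion)
  have "f \<in> content_space K \<mu> H p \<longleftrightarrow> M f \<in> content_space_nonneg K \<mu> H p"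
    if f: "f \<in> borel_measurable (completion \<mu>)" for f
  proof
    assume "f \<in> content_space K \<mu> H p"
    then have "ennreal C * version_norm K \<mu> H p f < \<infinity>"
      by (simp add: content_space_def ennreal_mult_less_top)
    then show "M f \<in> content_space_nonneg K \<mu> H p"
      using le_less_trans[OF upper] measurable by (simp add: content_space_nonneg_def)
  next
    assume "M f \<in> content_space_nonneg K \<mu> H p"
    then show "f \<in> content_space K \<mu> H p"
      using le_less_trans[OF lower[OF f]] f by (simp add: content_space_nonneg_def content_space_def)
  qed
  moreover have "version_norm K \<mu> H p f \<le> content_norm K H p (M f) \<and>
      content_norm K H p (M f) \<le> ennreal C * version_norm K \<mu> H p f"
    if "f \<in> content_space K \<mu> H p" for f
    using that lower upper by (simp add: content_space_def)
  ultimately show ?thesis using C(1) by blast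
qed

end
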